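(* For any street system law $\mathcal S$, any waypoint kernel $\kappa$, any velocity distribution $\mu$ and all $\lambda,T,r\ge0$ we have $$\rho_{\mathrm c}(T,\lambda,\mu,r)\le\min\{T/2,\ \rho_{\mathrm c}'(T,\mu)\}.$$
   Context: Street system. $S\subset\mathbb R^2$ is a stationary random planar segment process, i.e. a simple point process of line segments with lengths in $(0,\infty)$, with law $\mathcal S$; $S$ also denotes the union of the segments and $|S\cap B|$ the total length in $B\subset\mathbb R^2$. Put $Q_n(x)=x+[-n/2,n/2]^2$, $Q_n=Q_n(o)$. $S$ is normalized: $\mathbb E|S\cap Q_1|=1$. $S$ is assumed stabilizing: there is a random field $R=\{R_x\}_{x\in\mathbb R^2}$ (stabilization radii), measurable with respect to $S$, such that (i) $(S,R)$ is jointly stationary; (ii) $\lim_{n\uparrow\infty}\mathbb P(\sup_{y\in Q_n\cap\mathbb Q^2}R_y<n)=1$; (iii) for all $n\ge1$, all non-negative bounded measurable $f$ and all finite $\varphi\subset\mathbb R^2$ with $\mathrm{dist}(x,\varphi\setminus\{x\})>3n$ for all $x\in\varphi$, the random variables $f(S\cap Q_n(x))\mathbf 1\{\sup_{y\in Q_n(x)\cap\mathbb Q^2}R_y<n\}$, $x\in\varphi$, are independent. $S$ is also assumed asymptotically essentially connected: for all sufficiently large $n$, whenever $\sup_{y\in Q_{2n}\cap\mathbb Q^2}R_y<n/2$, then $|S\cap Q_n|>0$ and $S\cap Q_n$ is contained in one connected component of $S\cap Q_{2n}$. A crossing is an intersection point of two distinct segments of $S$ or an endpoint of a segment. Two distinct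 crossings are neighbors if they lie on the same segment and are not separated by another crossing; the part of a segment between two neighboring crossings is a street. Devices. Given $S$, the initial device positions $X^\lambda=\{X_i\}$ form a Poisson point process with intensity measure $A\mapsto\lambda|S\cap A|$, $\lambda\ge0$. A waypoint kernel $\kappa^S(x,\mathrm dy)$ is a probability kernel from points $x\in S$ to $S$, translation covariant: $\kappa^S(x,\mathrm dy)=\kappa^{S+z}(x+z,\mathrm dy+z)$ for all $z\in\mathbb R^2$. Each device $X_i$ independently picks a target $Y_i\sim\kappa^S(X_i,\cdot)$ and independently a velocity $V_i\sim\mu$. A velocity distribution $\mu$ is a probability measure on $[0,\infty)$ with $0<v_{\min}\le v_{\max}<\infty$, where $v_{\min}=\sup\{v:\mu([v,\infty))=1\}$, $v_{\max}=\inf\{v:\mu([0,v])=1\}$. Device $X_i$ moves with speed $V_i$ along the shortest path on $S$ to $Y_i$, immediately returns along the same path to $X_i$ with the same speed, and repeats this commute until the time horizon $T$; its position at time $t$ is $\mathcal T_{i,t}$. Connections. $Z(X_i,X_j)$ is the set of times $t\ge0$ at which $\mathcal T_{i,t}$ and $\mathcal T_{j,t}$ are on the same street and $|\mathcal T_{i,t}-\mathcal T_{j,t}|<r$ (for $r=0$: $\mathcal T_{i,t}=\mathcal T_{j,t}$). The graph $g_{T,\mu,\rho,r}(X^\lambda)$ has vertex set $X^\lambda$ and an edge between $X_i$ and $X_j$ iff $[t,t+\rho]\subset Z(X_i,X_j)$ for some $t\in[0,T-\rho]$ (no edges if $T<\rho$). It percolates if it contains an unbounded connected component. With $\sup\emptyset=-\infty$,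 put $$\rho_{\mathrm c}(T,\lambda,\mu,r)=\sup\{\rho\ge0:\mathbb P(g_{T,\mu,\rho,r}(X^\lambda)\text{ percolates})>0\}.$$ Auxiliary street percolation. For $a,b\ge0$, let $S^a$ be the thinned street system consisting of all streets of $S$ of length at least $a$ (the long streets). The graph $S^{a,b}$ consists of the long streets together with an additional edge between any two endpoints of long streets for which the length of the shortest path between them along the streets of $S$ does not exceed $b$. $S^{a,b}$ percolates if it contains an infinitely long component of connected streets and edges. Put $$\rho_{\mathrm c}'(T,\mu)=\sup\{0\le\rho\le T/2:\mathbb P(S^{v_{\min}\rho/2,\,v_{\max}(T-2\rho)}\text{ percolates})>0\}.$$ *)

theory Defs
  imports "HOL-Probability.Probability"
begin

section \<open>Segment configurations\<close>

type_synonym point = "real ^ 2"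
type_synonym config = "point set set"

definition segments :: "point set set" where
  "segments = {closed_segment a b |a b. a \<noteq> b}"

text \<open>The Borel structure on unordered segments is the quotient of the one on ordered pairs of
  distinct end points.\<close>

definition segment_space :: "point set measure" where
  "segment_space = sigma segments
     {A. A \<subseteq> segments \<and> {(a, b). a \<noteq> b \<and> closed_segment a b \<in> A} \<in> sets (borel :: (point \<times> point) measure)}"

definition configs :: "config set" where
  "configs = {\<phi>. \<phi> \<subseteq> segments \<and> (\<forall>B. bounded B \<longrightarrow> finite {s \<in> \<phi>. s \<inter> B \<noteq> {}})}"

text \<open>The usual \<open>\<sigma>\<close>-algebra of point process theory, generated by the counts of points in
  measurable sets. A simple point process is a random set, so no multiplicities are needed.\<close>

definition config_space :: "config measure" where
  "config_space = sigma configs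
     {{\<phi> \<in> configs. finite (\<phi> \<inter> A) \<and> card (\<phi> \<inter> A) = n} |A n. A \<in> sets segment_space}"

definition translate :: "point \<Rightarrow> config \<Rightarrow> config" where
  "translate z \<phi> = (\<lambda>s. (+) z ` s) ` \<phi>"

definition window :: "real \<Rightarrow> point \<Rightarrow> point set" where
  "window n x = {y. \<forall>i. \<bar>y $ i - x $ i\<bar> \<le> n / 2}"

text \<open>One-dimensional Hausdorff measure, so that \<open>street_length \<phi> B\<close> is the total length in \<open>B\<close>
  of the union of the segments.\<close>

definition hausdorff1 :: "point set \<Rightarrow> ennreal" where
  "hausdorff1 A = (SUP \<delta>\<in>{0<..}.
     INF C\<in>{C :: nat \<Rightarrow> point set. A \<subseteq> (\<Union>i. C i) \<and> (\<forall>i. bounded (C i) \<and> diameter (C i) \<le> \<delta>)}.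
       \<Sum>i. ennreal (diameter (C i)))"

definition street_length :: "config \<Rightarrow> point set \<Rightarrow> ennreal" where
  "street_length \<phi> B = hausdorff1 (\<Union>\<phi> \<inter> B)"

section \<open>Street system laws\<close>

text \<open>Fell \<open>\<sigma>\<close>-algebra on the closed subsets of the plane.\<close>

definition closed_space :: "point set measure" where
  "closed_space = sigma {C. closed C} {{C. closed C \<and> C \<inter> K \<noteq> {}} |K. compact K}"

definition sup_radius :: "(config \<Rightarrow> point \<Rightarrow> real) \<Rightarrow> config \<Rightarrow> point set \<Rightarrow> ereal" where
  "sup_radius R \<phi> B = (SUP y\<in>B \<inter> {y. \<forall>i. y $ i \<in> \<rat>}. ereal (R \<phi> y))"

text \<open>A random field that is measurable with respect to the segment process is a function \<open>R\<close> of
  the configuration.\<close>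

definition stabilization_field :: "config measure \<Rightarrow> (config \<Rightarrow> point \<Rightarrow> real) \<Rightarrow> bool" where
  "stabilization_field L R \<longleftrightarrow>
     (\<forall>x. (\<lambda>\<phi>. R \<phi> x) \<in> borel_measurable L) \<and>
     (\<forall>z. distr L (config_space \<Otimes>\<^sub>M Pi\<^sub>M UNIV (\<lambda>_. borel)) (\<lambda>\<phi>. (translate z \<phi>, \<lambda>x. R \<phi> (x - z)))
        = distr L (config_space \<Otimes>\<^sub>M Pi\<^sub>M UNIV (\<lambda>_. borel)) (\<lambda>\<phi>. (\<phi>, R \<phi>))) \<and>
     (\<lambda>n::nat. measure L {\<phi> \<in> space L. sup_radius R \<phi> (window (real n) 0) < ereal (real n)})
        \<longlonglongrightarrow> 1 \<and>
     (\<forall>n::nat. \<forall>f :: point set \<Rightarrow> real. \<forall>F :: point set.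
        1 \<le> n \<and> f \<in> borel_measurable closed_space \<and> (\<forall>C. closed C \<longrightarrow> 0 \<le> f C) \<and>
        (\<exists>c. \<forall>C. closed C \<longrightarrow> f C \<le> c) \<and> finite F \<and>
        (\<forall>x\<in>F. \<forall>y\<in>F - {x}. 3 * real n < dist x y) \<longrightarrow>
        prob_space.indep_vars L (\<lambda>_. borel)
          (\<lambda>x \<phi>. f (\<Union>\<phi> \<inter> window (real n) x) *
             of_bool (sup_radius R \<phi> (window (real n) x) < ereal (real n))) F)"

definition asymptotically_essentially_connected ::
    "config measure \<Rightarrow> (config \<Rightarrow> point \<Rightarrow> real) \<Rightarrow> bool" where
  "asymptotically_essentially_connected L R \<longleftrightarrow>
     (\<exists>n0::nat. \<forall>n\<ge>n0. AE \<phi> in L.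
        sup_radius R \<phi> (window (2 * real n) 0) < ereal (real n / 2) \<longrightarrow>
          0 < street_length \<phi> (window (real n) 0) \<and>
          (\<exists>C\<in>components (\<Union>\<phi> \<inter> window (2 * real n) 0). \<Union>\<phi> \<inter> window (real n) 0 \<subseteq> C))"

definition street_system_law :: "config measure \<Rightarrow> bool" where
  "street_system_law L \<longleftrightarrow>
     prob_space L \<and> sets L = sets config_space \<and>
     (\<forall>z. distr L config_space (translate z) = L) \<and>
     (\<integral>\<^sup>+\<phi>. street_length \<phi> (window 1 0) \<partial>L) = 1 \<and>
     (\<exists>R. stabilization_field L R \<and> asymptotically_essentially_connected L R)"

section \<open>Crossings, streets and paths\<close>

definition crossings :: "config \<Rightarrow> point set" where
  "crossings \<phi> = {x. (\<exists>s\<in>\<phi>. \<exists>s'\<in>\<phi>. s \<noteq> s' \<and> x \<in> s \<inter> s') \<or> (\<exists>y. closed_segment x y \<in> \<phi>)}"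

definition neighbors :: "config \<Rightarrow> point \<Rightarrow> point \<Rightarrow> bool" where
  "neighbors \<phi> p q \<longleftrightarrow> p \<in> crossings \<phi> \<and> q \<in> crossings \<phi> \<and> p \<noteq> q \<and>
     (\<exists>s\<in>\<phi>. p \<in> s \<and> q \<in> s) \<and> open_segment p q \<inter> crossings \<phi> = {}"

text \<open>A street is what lies strictly between two neighboring crossings. Crossings belong to no
  street and distinct streets are disjoint, so a pair of devices that is on the same street at
  all times of an interval stays on a single street.\<close>

definition streets :: "config \<Rightarrow> point set set" where
  "streets \<phi> = {open_segment p q |p q. neighbors \<phi> p q}"

definition curve_length :: "(real \<Rightarrow> point) \<Rightarrow> real \<Rightarrow> real \<Rightarrow> ennreal" where
  "curve_length g a b = (SUP (n, t)\<in>{(n :: nat, t :: nat \<Rightarrow> real). mono t \<and> range t \<subseteq> {a..b}}.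
     \<Sum>k<n. ennreal (dist (g (t k)) (g (t (Suc k)))))"

text \<open>Length of a shortest path in \<open>C\<close>; \<open>\<infinity>\<close> if there is no rectifiable path.\<close>

definition path_dist :: "point set \<Rightarrow> point \<Rightarrow> point \<Rightarrow> ennreal" where
  "path_dist C x y =
     (INF g\<in>{g. path g \<and> path_image g \<subseteq> C \<and> pathstart g = x \<and> pathfinish g = y}. curve_length g 0 1)"

text \<open>Shortest paths parametrized by arc length.\<close>

definition shortest_path :: "point set \<Rightarrow> point \<Rightarrow> point \<Rightarrow> real \<Rightarrow> (real \<Rightarrow> point) \<Rightarrow> bool" where
  "shortest_path C x y l g \<longleftrightarrow> 0 \<le> l \<and> continuous_on {0..l} g \<and> g ` {0..l} \<subseteq> C \<and> g 0 = x \<and> g l = y \<and>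
     (\<forall>s\<in>{0..l}. curve_length g 0 s = ennreal s) \<and> ennreal l = path_dist C x y"

text \<open>Position, measured from the start, after travelling a distance \<open>u\<close> back and forth on an
  interval of length \<open>l\<close>; it is \<open>0\<close> for \<open>l = 0\<close>.\<close>

definition zigzag :: "real \<Rightarrow> real \<Rightarrow> real" where
  "zigzag l u = l - \<bar>l - 2 * l * frac (u / (2 * l))\<bar>"

text \<open>Shortest paths need not be unique; any of them may be used.\<close>

definition commutes :: "point set \<Rightarrow> point \<Rightarrow> point \<Rightarrow> real \<Rightarrow> (real \<Rightarrow> point) \<Rightarrow> bool" where
  "commutes C x y v p \<longleftrightarrow>
     (\<exists>l g. shortest_path C x y l g \<and> (\<forall>t\<ge>0. p t = g (zigzag l (v * t))))"

section \<open>Devices\<close>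

definition waypoint_kernel :: "(config \<Rightarrow> point \<Rightarrow> point measure) \<Rightarrow> bool" where
  "waypoint_kernel \<kappa> \<longleftrightarrow>
     (\<forall>\<phi>\<in>configs. \<kappa> \<phi> \<in> restrict_space borel (\<Union>\<phi>) \<rightarrow>\<^sub>M prob_algebra borel \<and>
        (\<forall>x\<in>\<Union>\<phi>. (AE y in \<kappa> \<phi> x. y \<in> \<Union>\<phi>) \<and>
           (\<forall>z. \<kappa> (translate z \<phi>) (z + x) = distr (\<kappa> \<phi> x) borel ((+) z))))"

definition v_min :: "real measure \<Rightarrow> ereal" where
  "v_min \<mu> = (SUP v\<in>{v. 0 \<le> v \<and> measure \<mu> {v..} = 1}. ereal v)"

definition v_max :: "real measure \<Rightarrow> ereal" where
  "v_max \<mu> = (INF v\<in>{v. 0 \<le> v \<and> measure \<mu> {0..v} = 1}. ereal v)"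

definition velocity_distribution :: "real measure \<Rightarrow> bool" where
  "velocity_distribution \<mu> \<longleftrightarrow> prob_space \<mu> \<and> sets \<mu> = sets borel \<and> measure \<mu> {0..} = 1 \<and>
     0 < v_min \<mu> \<and> v_min \<mu> \<le> v_max \<mu> \<and> v_max \<mu> < \<infinity>"

text \<open>A realization of the model on an arbitrary probability space. The devices are indexed by the
  random set \<open>I\<close> of natural numbers; the values of \<open>X i\<close>, \<open>Y i\<close>, \<open>V i\<close> for \<open>i \<notin> I\<close> are irrelevant.
  Given the streets, the initial positions form a Poisson process; given the streets and the
  initial positions, targets and velocities are independent with the prescribed laws.\<close>

locale device_model = prob_space M for M :: "'w measure" +
  fixes L :: "config measure" and \<kappa> :: "config \<Rightarrow> point \<Rightarrow> point measure" and \<mu> :: "real measure"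
    and lam :: real and S :: "'w \<Rightarrow> config" and I :: "'w \<Rightarrow> nat set" and X Y :: "nat \<Rightarrow> 'w \<Rightarrow> point"
    and V :: "nat \<Rightarrow> 'w \<Rightarrow> real" and pos :: "nat \<Rightarrow> 'w \<Rightarrow> real \<Rightarrow> point"
  assumes S_measurable: "S \<in> M \<rightarrow>\<^sub>M config_space"
    and S_law: "distr M config_space S = L"
    and I_measurable: "\<And>i. {\<omega> \<in> space M. i \<in> I \<omega>} \<in> sets M"
    and X_measurable: "\<And>i. X i \<in> borel_measurable M"
    and Y_measurable: "\<And>i. Y i \<in> borel_measurable M"
    and V_measurable: "\<And>i. V i \<in> borel_measurable M"
    and positions_poisson: "\<And>(k :: nat) A (m :: nat \<Rightarrow> nat). \<lbrakk>disjoint_family_on A {..<k};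
          \<And>j. j < k \<Longrightarrow> A j \<in> sets borel \<and> bounded (A j)\<rbrakk> \<Longrightarrow>
        AE \<omega> in M. real_cond_exp M (vimage_algebra (space M) S config_space)
            (indicator {\<omega> \<in> space M. \<forall>j<k. finite {i \<in> I \<omega>. X i \<omega> \<in> A j} \<and>
                                            card {i \<in> I \<omega>. X i \<omega> \<in> A j} = m j}) \<omega>
          = (\<Prod>j<k. let \<Lambda> = lam * enn2real (street_length (S \<omega>) (A j))
                     in exp (- \<Lambda>) * \<Lambda> ^ m j / fact (m j))"
    and targets_velocities: "\<And>(J :: nat set) A B. \<lbrakk>finite J;
          \<And>i. i \<in> J \<Longrightarrow> A i \<in> sets borel \<and> B i \<in> sets borel\<rbrakk> \<Longrightarrow>
        AE \<omega> in M. real_cond_exp M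
            (vimage_algebra (space M) (\<lambda>\<omega>. (S \<omega>, \<lambda>i. (i \<in> I \<omega>, if i \<in> I \<omega> then X i \<omega> else 0)))
              (config_space \<Otimes>\<^sub>M Pi\<^sub>M UNIV (\<lambda>_. count_space UNIV \<Otimes>\<^sub>M borel)))
            (indicator {\<omega> \<in> space M. J \<subseteq> I \<omega> \<and> (\<forall>i\<in>J. Y i \<omega> \<in> A i \<and> V i \<omega> \<in> B i)}) \<omega>
          = of_bool (J \<subseteq> I \<omega>) * (\<Prod>i\<in>J. measure (\<kappa> (S \<omega>) (X i \<omega>)) (A i) * measure \<mu> (B i))"
    and motion: "AE \<omega> in M. \<forall>i\<in>I \<omega>. commutes (\<Union>(S \<omega>)) (X i \<omega>) (Y i \<omega>) (V i \<omega>) (pos i \<omega>)"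

section \<open>Connections and percolation\<close>

definition contact_times :: "config \<Rightarrow> real \<Rightarrow> (real \<Rightarrow> point) \<Rightarrow> (real \<Rightarrow> point) \<Rightarrow> real set" where
  "contact_times \<phi> r p q = {t. 0 \<le> t \<and> (\<exists>e\<in>streets \<phi>. p t \<in> e \<and> q t \<in> e) \<and>
     (if r = 0 then p t = q t else dist (p t) (q t) < r)}"

definition connection_graph ::
    "real \<Rightarrow> real \<Rightarrow> real \<Rightarrow> config \<Rightarrow> nat set \<Rightarrow> (nat \<Rightarrow> real \<Rightarrow> point) \<Rightarrow> (nat \<times> nat) set" where
  "connection_graph T \<rho> r \<phi> D p = {(i, j). i \<in> D \<and> j \<in> D \<and> i \<noteq> j \<and>
     (\<exists>t\<in>{0..T - \<rho>}. {t..t + \<rho>} \<subseteq> contact_times \<phi> r (p i) (p j))}"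

definition connection_percolates ::
    "real \<Rightarrow> real \<Rightarrow> real \<Rightarrow> config \<Rightarrow> nat set \<Rightarrow> (nat \<Rightarrow> point) \<Rightarrow> (nat \<Rightarrow> real \<Rightarrow> point) \<Rightarrow> bool" where
  "connection_percolates T \<rho> r \<phi> D x p \<longleftrightarrow>
     (\<exists>i\<in>D. \<not> bounded (x ` {j. (i, j) \<in> (connection_graph T \<rho> r \<phi> D p)\<^sup>*}))"

text \<open>Positive probability in the sense of outer probability, so that no measurability of the
  percolation events has to be presupposed.\<close>

definition positive_prob :: "'w measure \<Rightarrow> ('w \<Rightarrow> bool) \<Rightarrow> bool" where
  "positive_prob M P \<longleftrightarrow> \<not> (AE \<omega> in M. \<not> P \<omega>)"

lemma (in prob_space) positive_prob_iff:
  assumes "{\<omega> \<in> space M. P \<omega>} \<in> sets M"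
  shows "positive_prob M P \<longleftrightarrow> 0 < prob {\<omega> \<in> space M. P \<omega>}"
proof -
  have "(AE \<omega> in M. \<not> P \<omega>) \<longleftrightarrow> emeasure M {\<omega> \<in> space M. P \<omega>} = 0"
    using AE_iff_measurable[OF assms, of "\<lambda>\<omega>. \<not> P \<omega>"] by simp
  then show ?thesis
    by (simp add: positive_prob_def emeasure_eq_measure zero_less_measure_iff)
qed

text \<open>The critical value depends on \<open>\<lambda>\<close> and \<open>\<mu>\<close> through the realization \<open>S\<close>, \<open>I\<close>, \<open>X\<close>, \<open>pos\<close> of the model. The
  supremum is taken in the extended reals, where \<open>Sup {} = - \<infinity>\<close>.\<close>

definition rho_c :: "'w measure \<Rightarrow> ('w \<Rightarrow> config) \<Rightarrow> ('w \<Rightarrow> nat set) \<Rightarrow> (nat \<Rightarrow> 'w \<Rightarrow> point) \<Rightarrow>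
    (nat \<Rightarrow> 'w \<Rightarrow> real \<Rightarrow> point) \<Rightarrow> real \<Rightarrow> real \<Rightarrow> ereal" where
  "rho_c M S I X pos T r = Sup (ereal ` {\<rho>. 0 \<le> \<rho> \<and>
     positive_prob M (\<lambda>\<omega>. connection_percolates T \<rho> r (S \<omega>) (I \<omega>) (\<lambda>i. X i \<omega>) (\<lambda>i. pos i \<omega>))})"

section \<open>Auxiliary street percolation\<close>

text \<open>\<open>long_street \<phi> a p q\<close>: a street of length at least \<open>a\<close> with end points \<open>p\<close>, \<open>q\<close>.\<close>

definition long_street :: "config \<Rightarrow> real \<Rightarrow> point \<Rightarrow> point \<Rightarrow> bool" where
  "long_street \<phi> a p q \<longleftrightarrow> neighbors \<phi> p q \<and> a \<le> dist p q"

definition extra_edge :: "config \<Rightarrow> real \<Rightarrow> real \<Rightarrow> point \<Rightarrow> point \<Rightarrow> bool" where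
  "extra_edge \<phi> a b p q \<longleftrightarrow> p \<noteq> q \<and> (\<exists>p'. long_street \<phi> a p p') \<and> (\<exists>q'. long_street \<phi> a q q') \<and>
     path_dist (\<Union>\<phi>) p q \<le> ennreal b"

definition street_component :: "config \<Rightarrow> real \<Rightarrow> real \<Rightarrow> point \<Rightarrow> point set" where
  "street_component \<phi> a b p = {q. (\<lambda>u v. long_street \<phi> a u v \<or> extra_edge \<phi> a b u v)\<^sup>*\<^sup>* p q}"

text \<open>Both sums run over ordered pairs of end points, so every street and every edge is counted
  twice, which does not affect whether the total length is infinite.\<close>

definition street_percolates :: "config \<Rightarrow> real \<Rightarrow> real \<Rightarrow> bool" where
  "street_percolates \<phi> a b \<longleftrightarrow> (\<exists>p.
     infsum (\<lambda>(u, v). ennreal (dist u v)) {(u, v). u \<in> street_component \<phi> a b p \<and> long_street \<phi> a u v} +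
     infsum (\<lambda>(u, v). path_dist (\<Union>\<phi>) u v) {(u, v). u \<in> street_component \<phi> a b p \<and> extra_edge \<phi> a b u v}
     = \<infinity>)"

definition rho_c' :: "config measure \<Rightarrow> real \<Rightarrow> real measure \<Rightarrow> ereal" where
  "rho_c' L T \<mu> = Sup (ereal ` {\<rho>. 0 \<le> \<rho> \<and> \<rho> \<le> T / 2 \<and>
     positive_prob L (\<lambda>\<phi>. street_percolates \<phi> (real_of_ereal (v_min \<mu>) * \<rho> / 2)
                                              (real_of_ereal (v_max \<mu>) * (T - 2 * \<rho>)))})"

end

theory Submission
  imports Defs "HOL-Library.Transitive_Closure_Table"
begin

text \<open>Almost surely all velocities lie in \<open>[v\<^sub>m\<^sub>i\<^sub>n, v\<^sub>m\<^sub>a\<^sub>x]\<close> (\<open>velocity_AE\<close>), and on this event the comparison is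
  deterministic: if the connection graph for \<open>\<rho>\<close> has an unbounded component, then \<open>\<rho> \<le> T / 2\<close> and the
  long streets with their extra edges percolate for the same \<open>\<rho>\<close>
  (\<open>connection_percolates_imp_street_percolates\<close>).

  A connection forces both devices to stay on one common street for a time \<open>\<rho>\<close>. Suppose that a device of
  speed \<open>v\<close> has stays of length \<open>\<rho>\<close> on two different streets (\<open>stays_on_two_streets\<close>). Streets are disjoint,
  hence so are the two time intervals, and at most the time \<open>T - 2 * \<rho>\<close> passes between them. Since a street
  can only be left or entered through its end points (\<open>connected_leaves_street\<close>), the shortest path between
  suitable end points of the two streets has length at most \<open>v * (T - 2 * \<rho>)\<close>, so these end points
  coincide or are joined by an extra edge. Moreover neither street contains the whole route of the device. Within
  a stay the device therefore turns at most once, so one of its legs has length at least \<open>v * \<rho> / 2\<close>;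
  as the route is a shortest path, this leg is no longer than the street, which is thus long
  (\<open>street_length_ge_stay\<close>).

  Consequently the streets used by the devices of one component are either all the same, or all long and in the
  same component of the street graph (\<open>street_joined_component\<close>). They cannot be bounded, because each device
  starts within distance \<open>v\<^sub>m\<^sub>a\<^sub>x * T\<close> of a street that it uses. A single street is bounded, which excludes
  the first case and with it \<open>\<rho> > T / 2\<close>. In the second case, the street component reaches vertices at arbitrary
  distance from a fixed one and so has infinite length (\<open>dist_le_component_length\<close>).\<close>

section \<open>Back and forth motion on an interval\<close>

text \<open>The zigzag is the distance to the set of multiples of \<open>2 * l\<close>; this lemma and
  \<open>zigzag_attained\<close> replace the formula with fractional parts in all that follows.\<close>

lemma zigzag_eq:
  fixes k :: int and l u :: real
  assumes "0 < l" and "\<bar>u - 2 * l * k\<bar> \<le> l"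
  shows "zigzag l u = \<bar>u - 2 * l * k\<bar>"
proof (cases "2 * l * k \<le> u")
  case True
  have "\<lfloor>u / (2 * l)\<rfloor> = k"
    using assms True by (intro floor_unique) (auto simp: field_simps)
  then have "2 * l * frac (u / (2 * l)) = u - 2 * l * k"
    using assms(1) by (simp add: frac_def field_simps)
  then show ?thesis
    using assms True by (simp add: zigzag_def)
next
  case False
  have "\<lfloor>u / (2 * l)\<rfloor> = k - 1"
    using assms False by (intro floor_unique) (auto simp: field_simps)
  then have "frac (u / (2 * l)) = u / (2 * l) - (k - 1)"
    by (simp add: frac_def)
  then have "2 * l * frac (u / (2 * l)) = u - 2 * l * k + 2 * l"
    using assms(1) by (simp add: field_simps)
  then show ?thesis
    using assms False by (simp add: zigzag_def)
qed

lemma zigzag_attained: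
  fixes l u :: real
  assumes "0 < l"
  obtains k :: int where "\<bar>u - 2 * l * k\<bar> \<le> l" and "zigzag l u = \<bar>u - 2 * l * k\<bar>"
proof -
  have "\<bar>u / (2 * l) - round (u / (2 * l))\<bar> \<le> 1 / 2"
    using of_int_round_abs_le[of "u / (2 * l)"] by (simp add: abs_minus_commute)
  then have "2 * l * \<bar>u / (2 * l) - round (u / (2 * l))\<bar> \<le> 2 * l * (1 / 2)"
    using assms by (intro mult_left_mono) auto
  moreover have "2 * l * \<bar>u / (2 * l) - round (u / (2 * l))\<bar> = \<bar>2 * l * (u / (2 * l) - round (u / (2 * l)))\<bar>"
    using assms by (simp add: abs_mult)
  moreover have "2 * l * (u / (2 * l) - round (u / (2 * l))) = u - 2 * l * round (u / (2 * l))"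
    using assms by (simp add: field_simps)
  ultimately have "\<bar>u - 2 * l * round (u / (2 * l))\<bar> \<le> l"
    by simp
  then show thesis
    using zigzag_eq[OF assms] that by blast
qed

lemma zigzag_bounds:
  assumes "0 \<le> l"
  shows "0 \<le> zigzag l u" and "zigzag l u \<le> l"
proof -
  have "0 \<le> zigzag l u \<and> zigzag l u \<le> l"
  proof (cases "l = 0")
    case True
    then show ?thesis by (simp add: zigzag_def)
  next
    case False
    with assms have "0 < l" by simp
    then obtain k :: int where "\<bar>u - 2 * l * k\<bar> \<le> l" "zigzag l u = \<bar>u - 2 * l * k\<bar>"
      by (rule zigzag_attained)
    then show ?thesis by simp
  qed
  then show "0 \<le> zigzag l u" and "zigzag l u \<le> l"
    by auto
qed

lemma zigzag_le:
  fixes k :: int and l u :: real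
  assumes "0 < l"
  shows "zigzag l u \<le> \<bar>u - 2 * l * k\<bar>"
proof (cases "\<bar>u - 2 * l * k\<bar> \<le> l")
  case True
  then show ?thesis using zigzag_eq[OF assms] by simp
next
  case False
  then show ?thesis using zigzag_bounds(2)[of l u] assms by linarith
qed

lemma zigzag_le_add:
  assumes "0 \<le> l"
  shows "zigzag l u \<le> zigzag l w + \<bar>u - w\<bar>"
proof (cases "l = 0")
  case True
  then show ?thesis by (simp add: zigzag_def)
next
  case False
  with assms have "0 < l" by simp
  obtain k :: int where "zigzag l w = \<bar>w - 2 * l * k\<bar>"
    using zigzag_attained[OF \<open>0 < l\<close>] by blast
  with zigzag_le[OF \<open>0 < l\<close>, of u k] show ?thesis
    by linarith
qed

lemma zigzag_lipschitz:
  assumes "0 \<le> l"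
  shows "\<bar>zigzag l u - zigzag l w\<bar> \<le> \<bar>u - w\<bar>"
  using zigzag_le_add[OF assms, of u w] zigzag_le_add[OF assms, of w u] by linarith

lemma continuous_on_zigzag:
  assumes "0 \<le> l"
  shows "continuous_on A (zigzag l)"
proof -
  have "1-lipschitz_on A (zigzag l)"
    using zigzag_lipschitz[OF assms] by (auto simp: lipschitz_on_def dist_real_def)
  then show ?thesis
    by (rule lipschitz_on_continuous_on)
qed

lemma zigzag_multiple:
  fixes m :: int and l :: real
  assumes "0 < l"
  shows "zigzag l (m * l) = (if even m then 0 else l)"
proof (cases "even m")
  case True
  then obtain k where "m = 2 * k" by blast
  then show ?thesis using zigzag_eq[OF assms, of "m * l" k] True assms by simp
next
  case False
  then obtain k where "m = 2 * k + 1" by (elim oddE)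
  moreover have "(2 * real_of_int k + 1) * l - 2 * l * k = l"
    by (simp add: algebra_simps)
  ultimately show ?thesis using zigzag_eq[OF assms, of "m * l" k] False assms by simp
qed

lemma zigzag_isometry_between_turns:
  fixes m :: int and l s t :: real
  assumes "0 < l" and "m * l \<le> s" and "s \<le> t" and "t \<le> (m + 1) * l"
  shows "\<bar>zigzag l s - zigzag l t\<bar> = t - s"
proof (cases "even m")
  case True
  then obtain k where m: "m = 2 * k" by blast
  have "zigzag l s = \<bar>s - 2 * l * k\<bar>" "zigzag l t = \<bar>t - 2 * l * k\<bar>"
    using assms m by (intro zigzag_eq; simp add: algebra_simps)+
  then show ?thesis using assms m by (simp add: algebra_simps)
next
  case False
  then obtain k where m: "m = 2 * k + 1" by (elim oddE)
  have "zigzag l s = \<bar>s - 2 * l * (k + 1)\<bar>" "zigzag l t = \<bar>t - 2 * l * (k + 1)\<bar>"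
    using assms m zigzag_eq[of l s "k + 1"] zigzag_eq[of l t "k + 1"]
    by (simp_all add: algebra_simps)
  then show ?thesis using assms m by (simp add: algebra_simps)
qed

text \<open>Unless both ends of the interval are visited during a travel of length \<open>d\<close>, there is at most
  one turn, and then one of the two parts of the travel has length at least \<open>d / 2\<close>.\<close>

lemma zigzag_travel:
  assumes "0 < l" and "0 \<le> d"
  shows "(\<exists>s\<in>{u..u + d}. \<exists>t\<in>{u..u + d}. d / 2 \<le> zigzag l t - zigzag l s) \<or>
         zigzag l ` {u..u + d} = {0..l}"
proof -
  define m where "m = \<lceil>u / l\<rceil>"
  have "u / l \<le> m" "m - 1 < u / l"
    unfolding m_def by linarith+
  then have m: "u \<le> m * l" "(m - 1) * l < u"
    using assms(1) by (simp_all add: pos_divide_le_eq pos_less_divide_eq)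
  consider "u + d \<le> m * l" | "m * l < u + d" "u + d < (m + 1) * l" | "(m + 1) * l \<le> u + d"
    by linarith
  then show ?thesis
  proof cases
    case 1
    then have "\<bar>zigzag l u - zigzag l (u + d)\<bar> = d"
      using zigzag_isometry_between_turns[of l "m - 1" u "u + d"] assms m by simp
    then have "d / 2 \<le> zigzag l u - zigzag l (u + d) \<or> d / 2 \<le> zigzag l (u + d) - zigzag l u"
      using assms by linarith
    then show ?thesis
      using assms(2) by (metis add.right_neutral add_left_mono atLeastAtMost_iff order_refl)
  next
    case 2
    have "\<bar>zigzag l u - zigzag l (m * l)\<bar> = m * l - u"
      using zigzag_isometry_between_turns[of l "m - 1" u "m * l"] assms m by simp
    moreover have "\<bar>zigzag l (m * l) - zigzag l (u + d)\<bar> = u + d - m * l"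
      using zigzag_isometry_between_turns[of l m "m * l" "u + d"] assms 2 by simp
    moreover have "d / 2 \<le> m * l - u \<or> d / 2 \<le> u + d - m * l"
      by linarith
    ultimately have "d / 2 \<le> zigzag l u - zigzag l (m * l) \<or> d / 2 \<le> zigzag l (m * l) - zigzag l u \<or>
        d / 2 \<le> zigzag l (m * l) - zigzag l (u + d) \<or> d / 2 \<le> zigzag l (u + d) - zigzag l (m * l)"
      by linarith
    moreover have "u \<in> {u..u + d}" "m * l \<in> {u..u + d}" "u + d \<in> {u..u + d}"
      using 2 m assms by auto
    ultimately show ?thesis
      by meson
  next
    case 3
    have le: "m * l \<le> (m + 1) * l"
      using assms(1) by (simp add: algebra_simps)
    have "connected (zigzag l ` {u..u + d})"
      using assms by (intro connected_continuous_image continuous_on_zigzag) auto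
    moreover have "zigzag l (m * l) \<in> zigzag l ` {u..u + d}" "zigzag l ((m + 1) * l) \<in> zigzag l ` {u..u + d}"
      using 3 m le by (auto intro!: imageI)
    moreover have "{zigzag l (m * l), zigzag l ((m + 1) * l)} = {0, l}"
      using zigzag_multiple[OF assms(1), of m] zigzag_multiple[OF assms(1), of "m + 1"] by auto
    ultimately have "{0..l} \<subseteq> zigzag l ` {u..u + d}"
      by (intro connected_contains_Icc) (auto simp: doubleton_eq_iff)
    then show ?thesis
      using zigzag_bounds[of l] assms(1) by (intro disjI2 subset_antisym) auto
  qed
qed

section \<open>Shortest paths\<close>

lemma path_dist_le_lipschitz:
  assumes h: "1-lipschitz_on {0..d} h" and "0 \<le> d" and C: "h ` {0..d} \<subseteq> C"
  shows "path_dist C (h 0) (h d) \<le> ennreal d"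
proof -
  define g where "g = (\<lambda>x. h (d * x))"
  have im: "(\<lambda>x. d * x) ` {0..1} \<subseteq> {0..d}"
    using \<open>0 \<le> d\<close> by (auto intro: mult_left_le)
  have "continuous_on {0..d} h"
    using h by (rule lipschitz_on_continuous_on)
  then have "path g"
    unfolding path_def g_def using im
    by (intro continuous_on_compose2[of "{0..d}" h "{0..1}" "\<lambda>x. d * x"] continuous_on_mult_left
        continuous_on_id)
  moreover have "path_image g \<subseteq> C"
    using im C by (force simp: path_image_def g_def)
  moreover have "pathstart g = h 0" "pathfinish g = h d"
    by (simp_all add: g_def pathstart_def pathfinish_def)
  moreover have "curve_length g 0 1 \<le> ennreal d"
    unfolding curve_length_def
  proof (rule SUP_least, clarify)
    fix n and t :: "nat \<Rightarrow> real"
    assume t: "mono t" "range t \<subseteq> {0..1}"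
    have "(\<Sum>k<n. ennreal (dist (g (t k)) (g (t (Suc k))))) \<le> (\<Sum>k<n. ennreal (d * (t (Suc k) - t k)))"
    proof (intro sum_mono ennreal_leI)
      fix k
      have "d * t k \<in> {0..d}" "d * t (Suc k) \<in> {0..d}"
        using t im by blast+
      then have "dist (g (t k)) (g (t (Suc k))) \<le> dist (d * t k) (d * t (Suc k))"
        using lipschitz_onD[OF h] by (force simp: g_def)
      also have "\<dots> = d * (t (Suc k) - t k)"
        using \<open>0 \<le> d\<close> monoD[OF t(1), of k "Suc k"]
        by (simp add: dist_real_def abs_mult flip: right_diff_distrib)
      finally show "dist (g (t k)) (g (t (Suc k))) \<le> d * (t (Suc k) - t k)" .
    qed
    also have "\<dots> = ennreal (\<Sum>k<n. d * (t (Suc k) - t k))"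
      using \<open>0 \<le> d\<close> monoD[OF t(1)] by (intro sum_ennreal) auto
    also have "(\<Sum>k<n. d * (t (Suc k) - t k)) = d * (t n - t 0)"
      by (simp add: sum_lessThan_telescope flip: sum_distrib_left)
    also have "\<dots> \<le> d * 1"
      using t \<open>0 \<le> d\<close> by (intro mult_left_mono) (auto simp: image_subset_iff intro: order_trans[of _ "t n"])
    finally show "(\<Sum>k<n. ennreal (dist (g (t k)) (g (t (Suc k))))) \<le> ennreal d"
      by (simp add: ennreal_leI)
  qed
  ultimately show ?thesis
    unfolding path_dist_def by (intro INF_lower2[of g]) auto
qed

lemma dist_le_path_dist: "ennreal (dist x y) \<le> path_dist C x y"
  unfolding path_dist_def
proof (rule INF_greatest, clarify)
  fix g :: "real \<Rightarrow> point"
  define t where "t = (\<lambda>k::nat. if k = 0 then 0 else 1 :: real)"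
  have "mono t" "range t \<subseteq> {0..1}"
    by (auto simp: t_def mono_def)
  then have "(\<Sum>k<1. ennreal (dist (g (t k)) (g (t (Suc k))))) \<le> curve_length g 0 1"
    unfolding curve_length_def by (intro SUP_upper2[of "(1, t)"]) auto
  then show "ennreal (dist (pathstart g) (pathfinish g)) \<le> curve_length g 0 1"
    by (simp add: t_def pathstart_def pathfinish_def)
qed

lemma curve_length_add_dist_le:
  assumes "a \<le> s" and "s \<le> t"
  shows "curve_length g a s + ennreal (dist (g s) (g t)) \<le> curve_length g a t"
proof -
  let ?P = "{(n :: nat, \<tau> :: nat \<Rightarrow> real). mono \<tau> \<and> range \<tau> \<subseteq> {a..s}}"
  have "(0, \<lambda>_. a) \<in> ?P"
    using assms by (auto simp: mono_def)
  then have "?P \<noteq> {}"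
    by blast
  then have "curve_length g a s + ennreal (dist (g s) (g t)) =
      (SUP (n, \<tau>)\<in>?P. (\<Sum>k<n. ennreal (dist (g (\<tau> k)) (g (\<tau> (Suc k))))) + ennreal (dist (g s) (g t)))"
    unfolding curve_length_def by (subst ennreal_SUP_add_left[symmetric]) (auto simp: case_prod_beta)
  also have "\<dots> \<le> curve_length g a t"
  proof (rule SUP_least, clarify)
    fix n and \<tau> :: "nat \<Rightarrow> real"
    assume \<tau>: "mono \<tau>" "range \<tau> \<subseteq> {a..s}"
    \<comment> \<open>The partition is continued by the points \<open>s\<close> and \<open>t\<close>.\<close>
    define \<tau>' where "\<tau>' = (\<lambda>k. if k \<le> n then \<tau> k else if k = Suc n then s else t)"
    have "mono \<tau>'"
      using \<tau> assms by (auto simp: \<tau>'_def mono_def image_subset_iff intro: order_trans[of _ s])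
    moreover have "range \<tau>' \<subseteq> {a..t}"
      using \<tau> assms by (auto simp: \<tau>'_def image_subset_iff intro: order_trans[of _ s])
    ultimately have "(\<Sum>k<Suc (Suc n). ennreal (dist (g (\<tau>' k)) (g (\<tau>' (Suc k))))) \<le> curve_length g a t"
      unfolding curve_length_def
      by (intro SUP_upper2[of "(Suc (Suc n), \<tau>')"]) (auto simp del: sum_ennreal)
    moreover have "(\<Sum>k<n. ennreal (dist (g (\<tau>' k)) (g (\<tau>' (Suc k))))) =
        (\<Sum>k<n. ennreal (dist (g (\<tau> k)) (g (\<tau> (Suc k)))))"
      by (intro sum.cong) (auto simp: \<tau>'_def)
    ultimately show "(\<Sum>k<n. ennreal (dist (g (\<tau> k)) (g (\<tau> (Suc k))))) + ennreal (dist (g s) (g t))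
        \<le> curve_length g a t"
      by (auto simp: \<tau>'_def intro: order_trans[rotated])
  qed
  finally show ?thesis .
qed

lemma shortest_path_lipschitz:
  assumes "shortest_path C x y l g"
  shows "1-lipschitz_on {0..l} g"
proof (rule lipschitz_on_leI)
  fix s t :: real
  assume st: "s \<in> {0..l}" "t \<in> {0..l}" "s \<le> t"
  have len: "curve_length g 0 s = ennreal s" "curve_length g 0 t = ennreal t"
    using assms st by (auto simp: shortest_path_def)
  have "ennreal (s + dist (g s) (g t)) \<le> ennreal t"
    using curve_length_add_dist_le[of 0 s t g] st by (simp add: len ennreal_plus)
  then have "s + dist (g s) (g t) \<le> t"
    using st by (subst (asm) ennreal_le_iff) auto
  then show "dist (g s) (g t) \<le> 1 * dist s t"
    using st by (simp add: dist_real_def)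
qed simp

text \<open>A shortest path cannot gain anything from a straight shortcut inside \<open>C\<close>.\<close>

lemma shortest_path_shortcut:
  assumes g: "shortest_path C x y l g" and ab: "0 \<le> a" "a \<le> b" "b \<le> l"
    and seg: "closed_segment (g a) (g b) \<subseteq> C"
  shows "b - a \<le> dist (g a) (g b)"
proof -
  define d where "d = dist (g a) (g b)"
  have "0 \<le> d"
    by (simp add: d_def)
  have lip: "1-lipschitz_on {0..l} g"
    by (rule shortest_path_lipschitz[OF g])
  define c where "c = (\<lambda>s. g a + ((s - a) / d) *\<^sub>R (g b - g a))"
  define h where "h = (\<lambda>s. if s \<le> a + d then (if s \<le> a then g s else c s) else g (s - (a + d) + b))"
  have "dist (c s) (c t) \<le> \<bar>s - t\<bar>" for s t
  proof -
    have "c s - c t = ((s - t) / d) *\<^sub>R (g b - g a)"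
      by (simp add: c_def diff_divide_distrib algebra_simps)
    moreover have "norm (g b - g a) = d"
      by (simp add: d_def dist_norm norm_minus_commute)
    ultimately show ?thesis
      by (cases "d = 0") (simp_all add: dist_norm d_def)
  qed
  then have "1-lipschitz_on {a..a + d} c"
    by (auto simp: lipschitz_on_def dist_real_def)
  then have h1: "1-lipschitz_on {0..a + d} (\<lambda>s. if s \<le> a then g s else c s)"
    using ab by (intro lipschitz_on_concat lipschitz_on_subset[OF lip]) (auto simp: c_def)
  have ca: "c (a + d) = g b" "c a = g a"
    by (auto simp: c_def d_def)
  have "1-lipschitz_on {a + d..a + d + (l - b)} (\<lambda>s. g (s - (a + d) + b))"
    unfolding lipschitz_on_def
  proof safe
    fix s t
    assume "s \<in> {a + d..a + d + (l - b)}" "t \<in> {a + d..a + d + (l - b)}"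
    then have "s - (a + d) + b \<in> {0..l}" "t - (a + d) + b \<in> {0..l}"
      using ab by auto
    from lipschitz_onD[OF lip this]
    show "dist (g (s - (a + d) + b)) (g (t - (a + d) + b)) \<le> 1 * dist s t"
      by (simp add: dist_real_def)
  qed simp
  then have "1-lipschitz_on {0..a + d + (l - b)} h"
    unfolding h_def using ca \<open>0 \<le> d\<close>
    by (intro lipschitz_on_concat[OF h1]) auto
  moreover have "h ` {0..a + d + (l - b)} \<subseteq> C"
  proof
    fix z
    assume "z \<in> h ` {0..a + d + (l - b)}"
    then obtain s where s: "0 \<le> s" "s \<le> a + d + (l - b)" "z = h s"
      by auto
    have "c s \<in> closed_segment (g a) (g b)" if "a \<le> s" "s \<le> a + d"
      unfolding in_segment c_def using that \<open>0 \<le> d\<close>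
      by (intro exI[of _ "(s - a) / d"]) (auto simp: algebra_simps divide_le_eq)
    then show "z \<in> C"
      using g ab s seg by (auto simp: h_def shortest_path_def)
  qed
  ultimately have "path_dist C (h 0) (h (a + d + (l - b))) \<le> ennreal (a + d + (l - b))"
    using ab \<open>0 \<le> d\<close> by (intro path_dist_le_lipschitz) auto
  moreover have "h 0 = x" "h (a + d + (l - b)) = y"
    using g ab ca \<open>0 \<le> d\<close> by (auto simp: h_def shortest_path_def)
  ultimately have "ennreal l \<le> ennreal (a + d + (l - b))"
    using g by (simp add: shortest_path_def)
  then show ?thesis
    using ab \<open>0 \<le> d\<close> by (subst (asm) ennreal_le_iff) (auto simp: d_def)
qed

section \<open>Streets\<close>

lemma neighbors_sym: "neighbors \<phi> p q \<Longrightarrow> neighbors \<phi> q p"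
  by (auto simp: neighbors_def open_segment_commute)

text \<open>A street lies on exactly one segment, as a point on two segments would be a crossing.\<close>

lemma neighbors_segment:
  assumes "\<phi> \<in> configs" and "neighbors \<phi> p q"
  obtains s where "s \<in> \<phi>" and "closed_segment p q \<subseteq> s" and "closed (s - open_segment p q)"
    and "\<And>s'. s' \<in> \<phi> \<Longrightarrow> s' \<noteq> s \<Longrightarrow> s' \<inter> open_segment p q = {}"
proof -
  obtain s where s: "s \<in> \<phi>" "p \<in> s" "q \<in> s"
    using assms(2) by (auto simp: neighbors_def)
  obtain a b where ab: "s = closed_segment a b" "a \<noteq> b"
    using assms(1) s(1) by (auto simp: configs_def segments_def)
  have sub: "closed_segment p q \<subseteq> s"
    using s ab by (simp add: subset_closed_segment)
  define f where "f = (\<lambda>t. (1 - t) *\<^sub>R a + t *\<^sub>R b)"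
  have inj: "f t = f t' \<longleftrightarrow> t = t'" for t t'
  proof -
    have "f t - f t' = (t - t') *\<^sub>R (b - a)"
      by (simp add: f_def algebra_simps)
    then show ?thesis
      using ab(2) by (metis diff_eq_diff_eq eq_iff_diff_eq_0 scaleR_eq_0_iff)
  qed
  have f_comb: "(1 - u) *\<^sub>R f x + u *\<^sub>R f y = f ((1 - u) * x + u * y)" for u x y
    by (simp add: f_def algebra_simps)
  have img: "s = f ` {0..1}"
    by (auto simp: ab f_def closed_segment_def image_iff Bex_def)
  obtain x y where xy: "p = f x" "q = f y"
    using s unfolding img by auto
  have "x \<noteq> y"
    using assms(2) by (auto simp: neighbors_def xy)
  have "open_segment p q = (\<lambda>u. f ((1 - u) * x + u * y)) ` {0<..<1}"
    using \<open>x \<noteq> y\<close> by (simp add: open_segment_image_interval xy f_comb inj)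
  moreover have "open_segment x y = (\<lambda>u. (1 - u) * x + u * y) ` {0<..<1}"
    using \<open>x \<noteq> y\<close> by (simp add: open_segment_image_interval)
  ultimately have "open_segment p q = f ` open_segment x y"
    by (simp add: image_image)
  then have "s - open_segment p q = f ` ({0..1} - open_segment x y)"
    unfolding img by (auto simp: inj)
  moreover have "compact ({0..1} - open_segment x y)"
    by (intro compact_diff) (auto simp: open_segment_eq_real_ivl)
  moreover have "continuous_on A f" for A
    unfolding f_def by (intro continuous_intros)
  ultimately have "closed (s - open_segment p q)"
    by (simp add: compact_continuous_image compact_imp_closed)
  moreover have "s' \<inter> open_segment p q = {}" if "s' \<in> \<phi>" "s' \<noteq> s" for s'
  proof -
    have "s' \<inter> s \<subseteq> crossings \<phi>"
      using that s(1) by (auto simp: crossings_def)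
    then show ?thesis
      using assms(2) sub by (auto simp: neighbors_def open_segment_def)
  qed
  ultimately show thesis
    using that s(1) sub by blast
qed

lemma street_no_crossings: "neighbors \<phi> p q \<Longrightarrow> open_segment p q \<inter> crossings \<phi> = {}"
  by (simp add: neighbors_def)

lemma neighbors_crossings: "neighbors \<phi> p q \<Longrightarrow> p \<in> crossings \<phi>" "neighbors \<phi> p q \<Longrightarrow> q \<in> crossings \<phi>"
  by (simp_all add: neighbors_def)

lemma neighbors_neq: "neighbors \<phi> p q \<Longrightarrow> p \<noteq> q"
  by (simp add: neighbors_def)

text \<open>A street can only be left through its end points. The system of all segments is locally finite
  and the street meets only one of them, so the complement of the street in the street system is
  closed.\<close>

lemma connected_leaves_street:
  assumes \<phi>: "\<phi> \<in> configs" and pq: "neighbors \<phi> p q"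
    and D: "connected D" "bounded D" "D \<subseteq> \<Union>\<phi>" "D \<inter> open_segment p q \<noteq> {}" "\<not> D \<subseteq> open_segment p q"
  shows "p \<in> D \<or> q \<in> D"
proof (rule ccontr)
  assume neither: "\<not> (p \<in> D \<or> q \<in> D)"
  obtain s where s: "s \<in> \<phi>" "closed_segment p q \<subseteq> s" "closed (s - open_segment p q)"
    "\<And>s'. s' \<in> \<phi> \<Longrightarrow> s' \<noteq> s \<Longrightarrow> s' \<inter> open_segment p q = {}"
    using neighbors_segment[OF \<phi> pq] by metis
  define B where "B = (s - open_segment p q) \<union> \<Union>({s' \<in> \<phi>. s' \<inter> D \<noteq> {}} - {s})"
  have "finite ({s' \<in> \<phi>. s' \<inter> D \<noteq> {}} - {s})"
    using \<phi> D(2) by (auto simp: configs_def)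
  moreover have "closed s'" if "s' \<in> \<phi>" for s'
    using that \<phi> by (auto simp: configs_def segments_def)
  ultimately have "closed B"
    unfolding B_def using s(3) by (intro closed_Un closed_Union) auto
  moreover have "D \<subseteq> closed_segment p q \<union> B"
    using D(3) segment_open_subset_closed[of p q] unfolding B_def by blast
  moreover have "closed_segment p q \<inter> B \<inter> D = {}"
  proof -
    have "B \<inter> open_segment p q = {}"
      using s(4) unfolding B_def by blast
    then show ?thesis
      using neither by (auto simp: closed_segment_eq_open)
  qed
  moreover have "closed_segment p q \<inter> D \<noteq> {}"
    using D(4) segment_open_subset_closed[of p q] by blast
  moreover have "B \<inter> D \<noteq> {}"
  proof -
    obtain x where x: "x \<in> D" "x \<notin> open_segment p q"
      using D(5) by blast
    then have "x \<notin> closed_segment p q"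
      using neither by (auto simp: open_segment_def)
    then have "x \<in> B"
      using x \<open>D \<subseteq> closed_segment p q \<union> B\<close> by blast
    then show ?thesis
      using x by blast
  qed
  ultimately show False
    using connected_closedD[OF D(1), of "closed_segment p q" B] by auto
qed

lemma connected_subset_street:
  assumes "\<phi> \<in> configs" and "neighbors \<phi> p q" and "connected D" "bounded D" "D \<subseteq> \<Union>\<phi>"
    and "D \<inter> open_segment p q \<noteq> {}" and "D \<inter> crossings \<phi> = {}"
  shows "D \<subseteq> open_segment p q"
  using connected_leaves_street[OF assms(1-6)] assms(2,7) by (auto simp: neighbors_def)

lemma street_subset_Union:
  assumes "\<phi> \<in> configs" and "neighbors \<phi> p q"
  shows "open_segment p q \<subseteq> \<Union>\<phi>"
  using neighbors_segment[OF assms] segment_open_subset_closed by (metis Union_upper order_trans)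

lemma streets_disjoint:
  assumes "\<phi> \<in> configs" and "neighbors \<phi> p q" and "neighbors \<phi> p' q'"
    and "open_segment p q \<inter> open_segment p' q' \<noteq> {}"
  shows "open_segment p q = open_segment p' q'"
proof -
  have "open_segment c d \<subseteq> open_segment a b"
    if "neighbors \<phi> a b" "neighbors \<phi> c d" "open_segment c d \<inter> open_segment a b \<noteq> {}" for a b c d
    using that assms(1)
    by (intro connected_subset_street street_subset_Union street_no_crossings convex_connected
        convex_open_segment bounded_open_segment)
  then show ?thesis
    using assms by (metis inf_commute subset_antisym)
qed

section \<open>Commuting devices on streets\<close>

lemma commutes_start: "commutes C x y v p \<Longrightarrow> p 0 = x"
  by (auto simp: commutes_def shortest_path_def zigzag_def)

lemma commutes_in:
  assumes "commutes C x y v p" and "0 \<le> t"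
  shows "p t \<in> C"
proof -
  obtain l g where "shortest_path C x y l g" "p t = g (zigzag l (v * t))"
    using assms by (auto simp: commutes_def)
  then show ?thesis
    using zigzag_bounds[of l "v * t"] by (auto simp: shortest_path_def)
qed

lemma commutes_dist_le:
  assumes "commutes C x y v p" and "0 \<le> v" and "0 \<le> s" and "0 \<le> t"
  shows "dist (p s) (p t) \<le> v * \<bar>s - t\<bar>"
proof -
  obtain l g where g: "shortest_path C x y l g" and p: "p s = g (zigzag l (v * s))" "p t = g (zigzag l (v * t))"
    using assms by (auto simp: commutes_def)
  have "0 \<le> l"
    using g by (simp add: shortest_path_def)
  then have "zigzag l (v * s) \<in> {0..l}" "zigzag l (v * t) \<in> {0..l}"
    using zigzag_bounds by auto
  from lipschitz_onD[OF shortest_path_lipschitz[OF g] this]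
  have "dist (p s) (p t) \<le> \<bar>zigzag l (v * s) - zigzag l (v * t)\<bar>"
    by (simp add: p dist_real_def)
  also have "\<dots> \<le> \<bar>v * s - v * t\<bar>"
    by (rule zigzag_lipschitz[OF \<open>0 \<le> l\<close>])
  also have "\<dots> = v * \<bar>s - t\<bar>"
    using \<open>0 \<le> v\<close> by (simp add: abs_mult flip: right_diff_distrib)
  finally show ?thesis .
qed

lemma continuous_on_commutes:
  assumes "commutes C x y v p" and "0 \<le> v" and "A \<subseteq> {0..}"
  shows "continuous_on A p"
proof -
  have "v-lipschitz_on A p"
    using commutes_dist_le[OF assms(1,2)] assms(2,3) by (auto simp: lipschitz_on_def dist_real_def)
  then show ?thesis
    by (rule lipschitz_on_continuous_on)
qed

lemma commutes_path_dist_le: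
  assumes p: "commutes C x y v p" and "0 < v" and "0 \<le> s" and "0 \<le> t"
  shows "path_dist C (p s) (p t) \<le> ennreal (v * \<bar>s - t\<bar>)"
proof -
  define \<sigma> where "\<sigma> = sgn (t - s)"
  define h where "h = (\<lambda>u. p (s + \<sigma> * u / v))"
  have ge: "0 \<le> s + \<sigma> * u / v" if "u \<in> {0..v * \<bar>s - t\<bar>}" for u
  proof -
    have "0 \<le> u / v" "u / v \<le> \<bar>s - t\<bar>"
      using that \<open>0 < v\<close> by (auto simp: field_simps)
    then show ?thesis
      using assms by (auto simp: \<sigma>_def sgn_if abs_if split: if_splits)
  qed
  have "1-lipschitz_on {0..v * \<bar>s - t\<bar>} h"
    unfolding lipschitz_on_def
  proof safe
    fix u w
    assume uw: "u \<in> {0..v * \<bar>s - t\<bar>}" "w \<in> {0..v * \<bar>s - t\<bar>}"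
    have "dist (h u) (h w) \<le> v * \<bar>(s + \<sigma> * u / v) - (s + \<sigma> * w / v)\<bar>"
      unfolding h_def using \<open>0 < v\<close> uw by (intro commutes_dist_le[OF p] ge) auto
    also have "(s + \<sigma> * u / v) - (s + \<sigma> * w / v) = \<sigma> * ((u - w) / v)"
      by (simp add: diff_divide_distrib right_diff_distrib)
    also have "v * \<bar>\<sigma> * ((u - w) / v)\<bar> \<le> 1 * dist u w"
      using \<open>0 < v\<close> by (simp add: abs_mult dist_real_def \<sigma>_def sgn_if)
    finally show "dist (h u) (h w) \<le> 1 * dist u w" .
  qed simp
  moreover have "h ` {0..v * \<bar>s - t\<bar>} \<subseteq> C"
    unfolding h_def using commutes_in[OF p ge] by blast
  moreover have "h 0 = p s" "h (v * \<bar>s - t\<bar>) = p t"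
    using \<open>0 < v\<close> by (auto simp: h_def \<sigma>_def sgn_if)
  ultimately show ?thesis
    using path_dist_le_lipschitz[of "v * \<bar>s - t\<bar>" h C] \<open>0 < v\<close> by simp
qed

text \<open>A device that leaves a street at some time has turned at most once during a stay on it, since the
  street does not contain its whole route. As the route is a shortest path, the street is at least
  as long as the part of the route that is covered during the longer of the two legs.\<close>

lemma street_length_ge_stay:
  assumes \<phi>: "\<phi> \<in> configs" and ab: "neighbors \<phi> a b" and p: "commutes (\<Union>\<phi>) x y v p" and "0 < v"
    and "0 \<le> t" and "0 \<le> \<rho>" and stay: "p ` {t..t + \<rho>} \<subseteq> open_segment a b"
    and "0 \<le> s" and "p s \<notin> open_segment a b"
  shows "v * \<rho> / 2 \<le> dist a b"
proof -
  obtain l g where g: "shortest_path (\<Union>\<phi>) x y l g" and pg: "\<And>t. 0 \<le> t \<Longrightarrow> p t = g (zigzag l (v * t))"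
    using p by (auto simp: commutes_def)
  have "0 \<le> l"
    using g by (simp add: shortest_path_def)
  have "l \<noteq> 0"
  proof
    assume "l = 0"
    then have "p s = p t"
      using \<open>0 \<le> s\<close> \<open>0 \<le> t\<close> by (simp add: pg zigzag_def)
    then show False
      using stay \<open>0 \<le> \<rho>\<close> \<open>p s \<notin> open_segment a b\<close> by (auto simp: image_subset_iff)
  qed
  with \<open>0 \<le> l\<close> have "0 < l"
    by simp
  have visited: "g (zigzag l w) \<in> open_segment a b" if "w \<in> {v * t..v * t + v * \<rho>}" for w
  proof -
    have w: "t \<le> w / v" "w / v \<le> t + \<rho>"
      using that \<open>0 < v\<close> by (simp_all add: pos_le_divide_eq pos_divide_le_eq algebra_simps)
    then have "p (w / v) \<in> open_segment a b"
      using stay by auto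
    then show ?thesis
      using w \<open>0 \<le> t\<close> \<open>0 < v\<close> pg[of "w / v"] by simp
  qed
  from zigzag_travel[OF \<open>0 < l\<close>, of "v * \<rho>" "v * t"] \<open>0 < v\<close> \<open>0 \<le> \<rho>\<close>
  consider w w' where "w \<in> {v * t..v * t + v * \<rho>}" "w' \<in> {v * t..v * t + v * \<rho>}"
      "v * \<rho> / 2 \<le> zigzag l w' - zigzag l w"
    | "zigzag l ` {v * t..v * t + v * \<rho>} = {0..l}"
    by (auto simp del: atLeastAtMost_iff)
  then show ?thesis
  proof cases
    case 1
    let ?c = "g (zigzag l w)" and ?d = "g (zigzag l w')"
    have le: "zigzag l w \<le> zigzag l w'"
      using 1 \<open>0 < v\<close> \<open>0 \<le> \<rho>\<close> by (smt (verit) divide_nonneg_nonneg mult_nonneg_nonneg)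
    have cd: "?c \<in> open_segment a b" "?d \<in> open_segment a b"
      using 1 visited by auto
    then have "closed_segment ?c ?d \<subseteq> open_segment a b"
      by (simp add: closed_segment_subset convex_open_segment)
    then have "zigzag l w' - zigzag l w \<le> dist ?c ?d"
      using street_subset_Union[OF \<phi> ab] zigzag_bounds[OF \<open>0 \<le> l\<close>] le
      by (intro shortest_path_shortcut[OF g]) auto
    moreover have "dist ?c ?d \<le> dist a b"
    proof -
      have "dist ?c ?d \<le> dist ?c a \<or> dist ?c ?d \<le> dist ?c b"
        using cd segment_furthest_le[of ?d a b ?c] by (auto simp: dist_norm open_segment_def)
      moreover have "dist ?c a \<le> dist a b" "dist ?c b \<le> dist a b"
        using cd dist_in_closed_segment[of ?c a b] by (auto simp: open_segment_def)
      ultimately show ?thesis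
        by linarith
    qed
    ultimately show ?thesis
      using 1(3) by linarith
  next
    case 2
    have "zigzag l (v * s) \<in> {0..l}"
      using zigzag_bounds[OF \<open>0 \<le> l\<close>] by simp
    then obtain w where "w \<in> {v * t..v * t + v * \<rho>}" "zigzag l (v * s) = zigzag l w"
      unfolding 2[symmetric] by blast
    then show ?thesis
      using visited pg \<open>0 \<le> s\<close> \<open>p s \<notin> open_segment a b\<close> by metis
  qed
qed

text \<open>A trajectory \<open>p\<close> stays on the street between \<open>a\<close> and \<open>b\<close> for some time interval of length \<open>\<rho>\<close>
  before the time horizon \<open>T\<close>.\<close>

definition stays_on_street ::
    "config \<Rightarrow> real \<Rightarrow> real \<Rightarrow> (real \<Rightarrow> point) \<Rightarrow> point \<Rightarrow> point \<Rightarrow> bool" where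
  "stays_on_street \<phi> T \<rho> p a b \<longleftrightarrow> neighbors \<phi> a b \<and>
     (\<exists>t. 0 \<le> t \<and> t \<le> T - \<rho> \<and> p ` {t..t + \<rho>} \<subseteq> open_segment a b)"

lemma stays_on_two_streets_ordered:
  assumes \<phi>: "\<phi> \<in> configs" and p: "commutes (\<Union>\<phi>) x y v p" and "0 < v" and "0 \<le> \<rho>"
    and ab: "neighbors \<phi> a b" and ab': "neighbors \<phi> a' b'"
    and t: "0 \<le> t" "t \<le> t'" "t' \<le> T - \<rho>"
    and stay: "p ` {t..t + \<rho>} \<subseteq> open_segment a b" and stay': "p ` {t'..t' + \<rho>} \<subseteq> open_segment a' b'"
    and neq: "open_segment a b \<noteq> open_segment a' b'"
  shows "2 * \<rho> < T" and "v * \<rho> / 2 \<le> dist a b" and "v * \<rho> / 2 \<le> dist a' b'"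
    and "\<exists>c\<in>{a, b}. \<exists>c'\<in>{a', b'}. path_dist (\<Union>\<phi>) c c' \<le> ennreal (v * (T - 2 * \<rho>)) \<and>
           path_dist (\<Union>\<phi>) c' c \<le> ennreal (v * (T - 2 * \<rho>))"
proof -
  have disj: "open_segment a b \<inter> open_segment a' b' = {}"
    using streets_disjoint[OF \<phi> ab ab'] neq by blast
  have in_ab: "p u \<in> open_segment a b" if "t \<le> u" "u \<le> t + \<rho>" for u
    using stay that by auto
  have in_ab': "p u \<in> open_segment a' b'" if "t' \<le> u" "u \<le> t' + \<rho>" for u
    using stay' that by auto
  have pt': "p t' \<notin> open_segment a b" and pt: "p t \<notin> open_segment a' b'"
    using in_ab'[of t'] in_ab[of t] disj \<open>0 \<le> \<rho>\<close> by auto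
  have gap: "t + \<rho> < t'"
    using in_ab[of t'] pt' t by force
  then show "2 * \<rho> < T"
    using t by simp
  show "v * \<rho> / 2 \<le> dist a b"
    using t by (intro street_length_ge_stay[OF \<phi> ab p \<open>0 < v\<close> _ \<open>0 \<le> \<rho>\<close> stay _ pt']) auto
  show "v * \<rho> / 2 \<le> dist a' b'"
    using t by (intro street_length_ge_stay[OF \<phi> ab' p \<open>0 < v\<close> _ \<open>0 \<le> \<rho>\<close> stay' _ pt]) auto
  have image: "connected (p ` {u..w})" "bounded (p ` {u..w})" "p ` {u..w} \<subseteq> \<Union>\<phi>" if "0 \<le> u" for u w
  proof -
    have "continuous_on {u..w} p"
      using \<open>0 < v\<close> that by (intro continuous_on_commutes[OF p]) auto
    then show "connected (p ` {u..w})" "bounded (p ` {u..w})"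
      by (simp_all add: connected_continuous_image compact_continuous_image compact_imp_bounded)
    show "p ` {u..w} \<subseteq> \<Union>\<phi>"
      using commutes_in[OF p] that by auto
  qed
  have "a \<in> p ` {t + \<rho>..t'} \<or> b \<in> p ` {t + \<rho>..t'}"
  proof (rule connected_leaves_street[OF \<phi> ab])
    show "p ` {t + \<rho>..t'} \<inter> open_segment a b \<noteq> {}"
      using in_ab[of "t + \<rho>"] gap \<open>0 \<le> \<rho>\<close> by (force simp: disjoint_iff)
    show "\<not> p ` {t + \<rho>..t'} \<subseteq> open_segment a b"
      using pt' gap by (auto simp: image_subset_iff)
  qed (use image[of "t + \<rho>" t'] t \<open>0 \<le> \<rho>\<close> in auto)
  then obtain s where s: "t + \<rho> \<le> s" "s \<le> t'" "p s \<in> {a, b}"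
    by auto
  have "p s \<in> crossings \<phi>"
    using s(3) neighbors_crossings[OF ab] by auto
  then have ps: "p s \<notin> open_segment a' b'"
    using street_no_crossings[OF ab'] by blast
  have "a' \<in> p ` {s..t'} \<or> b' \<in> p ` {s..t'}"
  proof (rule connected_leaves_street[OF \<phi> ab'])
    show "p ` {s..t'} \<inter> open_segment a' b' \<noteq> {}"
      using in_ab'[of t'] s(2) \<open>0 \<le> \<rho>\<close> by (force simp: disjoint_iff)
    show "\<not> p ` {s..t'} \<subseteq> open_segment a' b'"
      using ps s by (auto simp: image_subset_iff)
  qed (use image[of s t'] s t \<open>0 \<le> \<rho>\<close> in auto)
  then obtain s' where s': "s \<le> s'" "s' \<le> t'" "p s' \<in> {a', b'}"
    by auto
  have "v * \<bar>s - s'\<bar> \<le> v * (T - 2 * \<rho>)" "v * \<bar>s' - s\<bar> \<le> v * (T - 2 * \<rho>)"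
    using s s' t \<open>0 < v\<close> by (auto intro!: mult_left_mono)
  then have "path_dist (\<Union>\<phi>) (p s) (p s') \<le> ennreal (v * (T - 2 * \<rho>))"
    "path_dist (\<Union>\<phi>) (p s') (p s) \<le> ennreal (v * (T - 2 * \<rho>))"
    using commutes_path_dist_le[OF p \<open>0 < v\<close>, of s s'] commutes_path_dist_le[OF p \<open>0 < v\<close>, of s' s] s s' t \<open>0 \<le> \<rho>\<close>
    by (auto intro: order_trans ennreal_leI)
  then show "\<exists>c\<in>{a, b}. \<exists>c'\<in>{a', b'}. path_dist (\<Union>\<phi>) c c' \<le> ennreal (v * (T - 2 * \<rho>)) \<and>
      path_dist (\<Union>\<phi>) c' c \<le> ennreal (v * (T - 2 * \<rho>))"
    using s(3) s'(3) by blast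
qed

text \<open>Two stays of one device on different streets do not overlap, so at most \<open>T - 2 * \<rho>\<close> time is left for
  the travel between the two streets.\<close>

lemma stays_on_two_streets:
  assumes \<phi>: "\<phi> \<in> configs" and p: "commutes (\<Union>\<phi>) x y v p" and "0 < v" and "0 \<le> \<rho>"
    and stay: "stays_on_street \<phi> T \<rho> p a b" and stay': "stays_on_street \<phi> T \<rho> p a' b'"
    and neq: "open_segment a b \<noteq> open_segment a' b'"
  shows "2 * \<rho> < T" and "v * \<rho> / 2 \<le> dist a b" and "v * \<rho> / 2 \<le> dist a' b'"
    and "\<exists>c\<in>{a, b}. \<exists>c'\<in>{a', b'}. path_dist (\<Union>\<phi>) c c' \<le> ennreal (v * (T - 2 * \<rho>)) \<and>
           path_dist (\<Union>\<phi>) c' c \<le> ennreal (v * (T - 2 * \<rho>))"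
proof -
  obtain t where ab: "neighbors \<phi> a b"
    and t: "0 \<le> t" "t \<le> T - \<rho>" "p ` {t..t + \<rho>} \<subseteq> open_segment a b"
    using stay by (auto simp: stays_on_street_def)
  obtain t' where ab': "neighbors \<phi> a' b'"
    and t': "0 \<le> t'" "t' \<le> T - \<rho>" "p ` {t'..t' + \<rho>} \<subseteq> open_segment a' b'"
    using stay' by (auto simp: stays_on_street_def)
  note rule = stays_on_two_streets_ordered[OF \<phi> p \<open>0 < v\<close> \<open>0 \<le> \<rho>\<close>]
  have "2 * \<rho> < T \<and> v * \<rho> / 2 \<le> dist a b \<and> v * \<rho> / 2 \<le> dist a' b' \<and>
    (\<exists>c\<in>{a, b}. \<exists>c'\<in>{a', b'}. path_dist (\<Union>\<phi>) c c' \<le> ennreal (v * (T - 2 * \<rho>)) \<and>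
           path_dist (\<Union>\<phi>) c' c \<le> ennreal (v * (T - 2 * \<rho>)))"
  proof (cases "t \<le> t'")
    case True
    from rule[OF ab ab' t(1) True t'(2) t(3) t'(3) neq] show ?thesis
      by blast
  next
    case False
    then have "t' \<le> t" by simp
    from rule[OF ab' ab t'(1) this t(2) t'(3) t(3) neq[symmetric]] show ?thesis
      by blast
  qed
  then show "2 * \<rho> < T" and "v * \<rho> / 2 \<le> dist a b" and "v * \<rho> / 2 \<le> dist a' b'"
    and "\<exists>c\<in>{a, b}. \<exists>c'\<in>{a', b'}. path_dist (\<Union>\<phi>) c c' \<le> ennreal (v * (T - 2 * \<rho>)) \<and>
           path_dist (\<Union>\<phi>) c' c \<le> ennreal (v * (T - 2 * \<rho>))"
    by auto
qed

lemma connection_common_street: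
  assumes \<phi>: "\<phi> \<in> configs" and "0 \<le> \<rho>"
    and comm: "\<And>i. i \<in> D \<Longrightarrow> 0 \<le> v i \<and> commutes (\<Union>\<phi>) (x i) (y i) (v i) (p i)"
    and edge: "(i, j) \<in> connection_graph T \<rho> r \<phi> D p"
  obtains a b where "stays_on_street \<phi> T \<rho> (p i) a b" and "stays_on_street \<phi> T \<rho> (p j) a b"
proof -
  obtain t where ij: "i \<in> D" "j \<in> D" and t: "0 \<le> t" "t \<le> T - \<rho>"
    and contact: "{t..t + \<rho>} \<subseteq> contact_times \<phi> r (p i) (p j)"
    using edge by (auto simp: connection_graph_def)
  have street: "\<exists>e\<in>streets \<phi>. p i s \<in> e \<and> p j s \<in> e" if "s \<in> {t..t + \<rho>}" for s
    using contact that by (auto simp: contact_times_def)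
  then obtain a b where ab: "neighbors \<phi> a b" "p i t \<in> open_segment a b" "p j t \<in> open_segment a b"
    using \<open>0 \<le> \<rho>\<close> unfolding streets_def by fastforce
  have "p k ` {t..t + \<rho>} \<subseteq> open_segment a b" if k: "k = i \<or> k = j" for k
  proof (rule connected_subset_street[OF \<phi> ab(1)])
    have p: "0 \<le> v k" "commutes (\<Union>\<phi>) (x k) (y k) (v k) (p k)"
      using k ij comm by auto
    have "continuous_on {t..t + \<rho>} (p k)"
      using t by (intro continuous_on_commutes[OF p(2,1)]) auto
    then show "connected (p k ` {t..t + \<rho>})" "bounded (p k ` {t..t + \<rho>})"
      by (simp_all add: connected_continuous_image compact_continuous_image compact_imp_bounded)
    show "p k ` {t..t + \<rho>} \<subseteq> \<Union>\<phi>"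
      using commutes_in[OF p(2)] t by auto
    show "p k ` {t..t + \<rho>} \<inter> open_segment a b \<noteq> {}"
      using k ab \<open>0 \<le> \<rho>\<close> by (force simp: disjoint_iff)
    show "p k ` {t..t + \<rho>} \<inter> crossings \<phi> = {}"
      using street k street_no_crossings unfolding streets_def by blast
  qed
  then show thesis
    using that[of a b] ab(1) t unfolding stays_on_street_def by blast
qed

section \<open>Long streets joined by short detours\<close>

text \<open>The total length of the component of \<open>p\<close>, with every street and every edge counted twice.\<close>

definition component_length :: "config \<Rightarrow> real \<Rightarrow> real \<Rightarrow> point \<Rightarrow> ennreal" where
  "component_length \<phi> a b p =
     infsum (\<lambda>(u, v). ennreal (dist u v)) {(u, v). u \<in> street_component \<phi> a b p \<and> long_street \<phi> a u v} +
     infsum (\<lambda>(u, v). path_dist (\<Union>\<phi>) u v) {(u, v). u \<in> street_component \<phi> a b p \<and> extra_edge \<phi> a b u v}"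

lemma street_component_step:
  assumes "u \<in> street_component \<phi> a b p" and "long_street \<phi> a u v \<or> extra_edge \<phi> a b u v"
  shows "v \<in> street_component \<phi> a b p"
  using assms unfolding street_component_def by (auto intro: rtranclp.rtrancl_into_rtrancl)

lemma long_street_sym: "long_street \<phi> a u v \<Longrightarrow> long_street \<phi> a v u"
  by (auto simp: long_street_def neighbors_sym dist_commute)

lemma path_edges_reachable:
  assumes "rtrancl_path R x xs y" and "(u, v) \<in> set (zip (x # xs) xs)"
  shows "R\<^sup>*\<^sup>* x u \<and> R u v"
  using assms
proof (induction rule: rtrancl_path.induct)
  case (base x)
  then show ?case by simp
next
  case (step x y ys z)
  then show ?case
    by (auto intro: converse_rtranclp_into_rtranclp)
qed

lemma dist_le_sum_path_edges:
  fixes x y :: "'a :: metric_space"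
  assumes "rtrancl_path R x xs y" and "distinct (x # xs)"
  shows "dist x y \<le> (\<Sum>(u, v)\<in>set (zip (x # xs) xs). dist u v)"
  using assms
proof (induction rule: rtrancl_path.induct)
  case (base x)
  then show ?case by simp
next
  case (step x y ys z)
  have "(x, y) \<notin> set (zip (y # ys) ys)"
    using step.prems by (metis distinct.simps(2) set_zip_leftD)
  then have "(\<Sum>(u, v)\<in>set (zip (x # y # ys) (y # ys)). dist u v) =
      dist x y + (\<Sum>(u, v)\<in>set (zip (y # ys) ys). dist u v)"
    by simp
  moreover have "dist y z \<le> (\<Sum>(u, v)\<in>set (zip (y # ys) ys). dist u v)"
    using step by simp
  moreover have "dist x z \<le> dist x y + dist y z"
    by (rule dist_triangle)
  ultimately show ?case
    by linarith
qed

lemma sum_le_infsum_ennreal: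
  fixes f :: "'a \<Rightarrow> ennreal"
  assumes "finite F" and "F \<subseteq> A"
  shows "sum f F \<le> infsum f A"
  using assms by (subst nonneg_infsum_complete) (auto intro: SUP_upper)

text \<open>A vertex of a component is reached along a path without repetitions, whose edges are distinct.\<close>

lemma dist_le_component_length:
  assumes "u \<in> street_component \<phi> a b p"
  shows "ennreal (dist p u) \<le> component_length \<phi> a b p"
proof -
  define R where "R = (\<lambda>u v. long_street \<phi> a u v \<or> extra_edge \<phi> a b u v)"
  have comp: "street_component \<phi> a b p = {q. R\<^sup>*\<^sup>* p q}"
    by (simp add: street_component_def R_def)
  obtain xs where xs: "rtrancl_path R p xs u" "distinct (p # xs)"
    using assms unfolding comp rtranclp_eq_rtrancl_path mem_Collect_eq
    by (metis rtrancl_path_distinct)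
  define F where "F = set (zip (p # xs) xs)"
  define G where "G = {(u, v) \<in> F. long_street \<phi> a u v}"
  have "finite F" "G \<subseteq> F"
    by (auto simp: F_def G_def)
  have F: "u \<in> street_component \<phi> a b p \<and> R u v" if "(u, v) \<in> F" for u v
    using path_edges_reachable[OF xs(1)] that by (auto simp: F_def comp)
  have "ennreal (dist p u) \<le> ennreal (\<Sum>(u, v)\<in>F. dist u v)"
    unfolding F_def by (intro ennreal_leI dist_le_sum_path_edges[OF xs])
  also have "\<dots> = (\<Sum>(u, v)\<in>F. ennreal (dist u v))"
    by (simp add: case_prod_beta)
  also have "\<dots> = (\<Sum>(u, v)\<in>G. ennreal (dist u v)) + (\<Sum>(u, v)\<in>F - G. ennreal (dist u v))"
    using \<open>finite F\<close> \<open>G \<subseteq> F\<close> by (simp add: sum.subset_diff add.commute)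
  also have "\<dots> \<le> component_length \<phi> a b p"
    unfolding component_length_def
  proof (rule add_mono)
    show "(\<Sum>(u, v)\<in>G. ennreal (dist u v)) \<le> infsum (\<lambda>(u, v). ennreal (dist u v))
        {(u, v). u \<in> street_component \<phi> a b p \<and> long_street \<phi> a u v}"
      using F \<open>finite F\<close> \<open>G \<subseteq> F\<close> by (intro sum_le_infsum_ennreal) (auto simp: G_def intro: finite_subset)
    have "(\<Sum>(u, v)\<in>F - G. ennreal (dist u v)) \<le> (\<Sum>(u, v)\<in>F - G. path_dist (\<Union>\<phi>) u v)"
      by (intro sum_mono) (auto simp: dist_le_path_dist)
    also have "\<dots> \<le> infsum (\<lambda>(u, v). path_dist (\<Union>\<phi>) u v)
        {(u, v). u \<in> street_component \<phi> a b p \<and> extra_edge \<phi> a b u v}"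
      using F \<open>finite F\<close> by (intro sum_le_infsum_ennreal) (auto simp: G_def R_def)
    finally show "(\<Sum>(u, v)\<in>F - G. ennreal (dist u v)) \<le> infsum (\<lambda>(u, v). path_dist (\<Union>\<phi>) u v)
        {(u, v). u \<in> street_component \<phi> a b p \<and> extra_edge \<phi> a b u v}" .
  qed
  finally show ?thesis .
qed

section \<open>From connected devices to connected streets\<close>

lemma same_street_ends:
  assumes "neighbors \<phi> p q" and "open_segment p q = open_segment p' q'"
  shows "{p, q} = {p', q'}"
  using assms neighbors_neq by (auto simp: open_segment_eq)

text \<open>The street between \<open>c\<close> and \<open>d\<close> is the reference street between \<open>p\<close> and \<open>q\<close>, or both are long and
  lie in the same component of the long streets with extra edges of length at most \<open>b\<close>. The second
  alternative requires \<open>b > 0\<close>: without travel time between two stays, a device sees only one street.\<close>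

definition street_joined :: "config \<Rightarrow> real \<Rightarrow> real \<Rightarrow> point \<Rightarrow> point \<Rightarrow> point \<Rightarrow> point \<Rightarrow> bool" where
  "street_joined \<phi> a b p q c d \<longleftrightarrow> open_segment c d = open_segment p q \<or>
     (0 < b \<and> long_street \<phi> a p q \<and> long_street \<phi> a c d \<and>
      c \<in> street_component \<phi> a b p \<and> d \<in> street_component \<phi> a b p)"

lemma street_joined_same_device:
  assumes \<phi>: "\<phi> \<in> configs" and comm: "commutes (\<Union>\<phi>) x y v p" and v: "0 < v" "vm \<le> v" "v \<le> vM" and "0 \<le> \<rho>"
    and stay: "stays_on_street \<phi> T \<rho> p c d" and stay': "stays_on_street \<phi> T \<rho> p c' d'"
    and pq: "neighbors \<phi> p\<^sub>0 q\<^sub>0"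
    and joined: "street_joined \<phi> (vm * \<rho> / 2) (vM * (T - 2 * \<rho>)) p\<^sub>0 q\<^sub>0 c d"
  shows "street_joined \<phi> (vm * \<rho> / 2) (vM * (T - 2 * \<rho>)) p\<^sub>0 q\<^sub>0 c' d'"
proof (cases "open_segment c d = open_segment c' d'")
  case True
  have "neighbors \<phi> c d"
    using stay by (simp add: stays_on_street_def)
  from same_street_ends[OF this True] have "c = c' \<and> d = d' \<or> c = d' \<and> d = c'"
    by (auto simp: doubleton_eq_iff)
  then show ?thesis
    using joined by (auto simp: street_joined_def long_street_sym open_segment_commute)
next
  case False
  let ?a = "vm * \<rho> / 2" and ?b = "vM * (T - 2 * \<rho>)"
  let ?K = "street_component \<phi> ?a ?b p\<^sub>0"
  note two = stays_on_two_streets[OF \<phi> comm v(1) \<open>0 \<le> \<rho>\<close> stay stay' False]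
  have "?a \<le> v * \<rho> / 2" "v * (T - 2 * \<rho>) \<le> ?b"
    using v two(1) \<open>0 \<le> \<rho>\<close> by (auto intro!: divide_right_mono mult_right_mono)
  with two stay stay' have long: "long_street \<phi> ?a c d" "long_street \<phi> ?a c' d'"
    by (auto simp: long_street_def stays_on_street_def)
  have K: "long_street \<phi> ?a p\<^sub>0 q\<^sub>0 \<and> c \<in> ?K \<and> d \<in> ?K"
  proof (cases "open_segment c d = open_segment p\<^sub>0 q\<^sub>0")
    case True
    then have "c = p\<^sub>0 \<and> d = q\<^sub>0 \<or> c = q\<^sub>0 \<and> d = p\<^sub>0"
      using long(1) same_street_ends[of \<phi> c d p\<^sub>0 q\<^sub>0] by (auto simp: long_street_def doubleton_eq_iff)
    moreover have "p\<^sub>0 \<in> ?K"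
      by (simp add: street_component_def)
    ultimately show ?thesis
      using long(1) long_street_sym street_component_step by metis
  next
    case False
    then show ?thesis
      using joined unfolding street_joined_def by blast
  qed
  obtain e e' where e: "e \<in> {c, d}" "e' \<in> {c', d'}" "path_dist (\<Union>\<phi>) e e' \<le> ennreal (v * (T - 2 * \<rho>))"
    using two(4) by blast
  then have "path_dist (\<Union>\<phi>) e e' \<le> ennreal ?b"
    using \<open>v * (T - 2 * \<rho>) \<le> ?b\<close> by (auto intro: order_trans ennreal_leI)
  then have "e = e' \<or> extra_edge \<phi> ?a ?b e e'"
    unfolding extra_edge_def using e long long_street_sym by blast
  then have "e' \<in> ?K"
    using K e street_component_step by blast
  then have "c' \<in> ?K \<and> d' \<in> ?K"
    using e(2) long(2) long_street_sym street_component_step by blast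
  moreover have "0 < ?b"
    using two(1) v by simp
  ultimately show ?thesis
    using K long by (simp add: street_joined_def)
qed

lemma street_joined_component:
  assumes \<phi>: "\<phi> \<in> configs" and "0 < vm" and "0 \<le> \<rho>"
    and comm: "\<And>i. i \<in> D \<Longrightarrow> vm \<le> v i \<and> v i \<le> vM \<and> commutes (\<Union>\<phi>) (x i) (y i) (v i) (p i)"
    and "i \<in> D" and stay: "stays_on_street \<phi> T \<rho> (p i) p\<^sub>0 q\<^sub>0"
    and path: "(i, j) \<in> (connection_graph T \<rho> r \<phi> D p)\<^sup>*"
  shows "j \<in> D \<and> (\<exists>c d. stays_on_street \<phi> T \<rho> (p j) c d) \<and>
    (\<forall>c d. stays_on_street \<phi> T \<rho> (p j) c d \<longrightarrow>
       street_joined \<phi> (vm * \<rho> / 2) (vM * (T - 2 * \<rho>)) p\<^sub>0 q\<^sub>0 c d)"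
  using path
proof (induction rule: rtrancl_induct)
  case base
  have "street_joined \<phi> (vm * \<rho> / 2) (vM * (T - 2 * \<rho>)) p\<^sub>0 q\<^sub>0 c d"
    if "stays_on_street \<phi> T \<rho> (p i) c d" for c d
  proof -
    have *: "commutes (\<Union>\<phi>) (x i) (y i) (v i) (p i)" "0 < v i" "vm \<le> v i" "v i \<le> vM"
      using comm[OF \<open>i \<in> D\<close>] \<open>0 < vm\<close> by auto
    show ?thesis
    proof (rule street_joined_same_device[OF \<phi> * \<open>0 \<le> \<rho>\<close> stay that])
      show "neighbors \<phi> p\<^sub>0 q\<^sub>0"
        using stay by (simp add: stays_on_street_def)
      show "street_joined \<phi> (vm * \<rho> / 2) (vM * (T - 2 * \<rho>)) p\<^sub>0 q\<^sub>0 p\<^sub>0 q\<^sub>0"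
        by (simp add: street_joined_def)
    qed
  qed
  then show ?case
    using \<open>i \<in> D\<close> stay by blast
next
  case (step j k)
  have "k \<in> D"
    using step.hyps by (auto simp: connection_graph_def)
  have "0 \<le> v n \<and> commutes (\<Union>\<phi>) (x n) (y n) (v n) (p n)" if "n \<in> D" for n
    using comm[OF that] \<open>0 < vm\<close> by auto
  from connection_common_street[OF \<phi> \<open>0 \<le> \<rho>\<close> this step.hyps(2)]
  obtain c d where cd: "stays_on_street \<phi> T \<rho> (p j) c d" "stays_on_street \<phi> T \<rho> (p k) c d"
    by blast
  have "street_joined \<phi> (vm * \<rho> / 2) (vM * (T - 2 * \<rho>)) p\<^sub>0 q\<^sub>0 c' d'"
    if "stays_on_street \<phi> T \<rho> (p k) c' d'" for c' d'
  proof -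
    have *: "commutes (\<Union>\<phi>) (x k) (y k) (v k) (p k)" "0 < v k" "vm \<le> v k" "v k \<le> vM"
      using comm[OF \<open>k \<in> D\<close>] \<open>0 < vm\<close> by auto
    show ?thesis
    proof (rule street_joined_same_device[OF \<phi> * \<open>0 \<le> \<rho>\<close> cd(2) that])
      show "neighbors \<phi> p\<^sub>0 q\<^sub>0"
        using stay by (simp add: stays_on_street_def)
      show "street_joined \<phi> (vm * \<rho> / 2) (vM * (T - 2 * \<rho>)) p\<^sub>0 q\<^sub>0 c d"
        using step.IH cd(1) by blast
    qed
  qed
  then show ?case
    using \<open>k \<in> D\<close> cd by blast
qed

lemma connection_percolates_imp_street_percolates:
  assumes \<phi>: "\<phi> \<in> configs" and "0 < vm" and "vm \<le> vM" and "0 \<le> \<rho>"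
    and comm: "\<And>i. i \<in> D \<Longrightarrow> vm \<le> v i \<and> v i \<le> vM \<and> commutes (\<Union>\<phi>) (x i) (y i) (v i) (p i)"
    and perc: "connection_percolates T \<rho> r \<phi> D x p"
  shows "\<rho> \<le> T / 2" and "street_percolates \<phi> (vm * \<rho> / 2) (vM * (T - 2 * \<rho>))"
proof -
  let ?G = "connection_graph T \<rho> r \<phi> D p"
  let ?a = "vm * \<rho> / 2" and ?b = "vM * (T - 2 * \<rho>)"
  obtain i where "i \<in> D" and unbdd: "\<not> bounded (x ` {j. (i, j) \<in> ?G\<^sup>*})"
    using perc by (auto simp: connection_percolates_def)
  obtain k where ik: "(i, k) \<in> ?G"
  proof (rule ccontr)
    assume "\<not> thesis"
    then have "{j. (i, j) \<in> ?G\<^sup>*} = {i}"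
      using that by (auto elim: converse_rtranclE)
    with unbdd show False
      by simp
  qed
  have "0 \<le> v n \<and> commutes (\<Union>\<phi>) (x n) (y n) (v n) (p n)" if "n \<in> D" for n
    using comm[OF that] \<open>0 < vm\<close> by auto
  from connection_common_street[OF \<phi> \<open>0 \<le> \<rho>\<close> this ik]
  obtain p\<^sub>0 q\<^sub>0 where stay: "stays_on_street \<phi> T \<rho> (p i) p\<^sub>0 q\<^sub>0"
    by blast
  have joined: "street_joined \<phi> ?a ?b p\<^sub>0 q\<^sub>0 c d"
    if "(i, j) \<in> ?G\<^sup>*" "stays_on_street \<phi> T \<rho> (p j) c d" for j c d
    using street_joined_component[OF \<phi> \<open>0 < vm\<close> \<open>0 \<le> \<rho>\<close> comm \<open>i \<in> D\<close> stay that(1)] that(2) by blast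
  \<comment> \<open>Until time \<open>T\<close> a device covers at most the distance \<open>vM * T\<close>, so the initial positions in the
    component are bounded if the streets used are.\<close>
  have unbdd_streets: False
    if W: "bounded W" "\<And>j c d. (i, j) \<in> ?G\<^sup>* \<Longrightarrow> stays_on_street \<phi> T \<rho> (p j) c d \<Longrightarrow> open_segment c d \<subseteq> W" for W
  proof -
    obtain R where R: "W \<subseteq> cball 0 R"
      using bounded_subset_ballD[OF W(1), of 0] ball_subset_cball by blast
    have "x j \<in> cball 0 (R + vM * T)" if j: "(i, j) \<in> ?G\<^sup>*" for j
    proof -
      obtain c d where "j \<in> D" and cd: "stays_on_street \<phi> T \<rho> (p j) c d"
        using street_joined_component[OF \<phi> \<open>0 < vm\<close> \<open>0 \<le> \<rho>\<close> comm \<open>i \<in> D\<close> stay j] by blast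
      then obtain t where t: "0 \<le> t" "t \<le> T - \<rho>" "p j ` {t..t + \<rho>} \<subseteq> open_segment c d"
        by (auto simp: stays_on_street_def)
      then have "p j t \<in> open_segment c d"
        using \<open>0 \<le> \<rho>\<close> by (auto simp: image_subset_iff)
      then have "p j t \<in> cball 0 R"
        using W(2)[OF j cd] R by blast
      have vj: "0 \<le> v j" "v j \<le> vM" "commutes (\<Union>\<phi>) (x j) (y j) (v j) (p j)"
        using comm[OF \<open>j \<in> D\<close>] \<open>0 < vm\<close> by auto
      have "dist (x j) (p j t) \<le> v j * t"
        using commutes_dist_le[OF vj(3,1), of 0 t] commutes_start[OF vj(3)] t by simp
      also have "\<dots> \<le> vM * T"
        using vj t \<open>0 \<le> \<rho>\<close> by (intro mult_mono) auto
      finally have "dist (x j) (p j t) \<le> vM * T" .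
      moreover have "dist 0 (x j) \<le> dist 0 (p j t) + dist (x j) (p j t)"
        by (metis dist_commute dist_triangle)
      ultimately show ?thesis
        using \<open>p j t \<in> cball 0 R\<close> by simp
    qed
    then have "x ` {j. (i, j) \<in> ?G\<^sup>*} \<subseteq> cball 0 (R + vM * T)"
      by blast
    with unbdd show False
      using bounded_cball bounded_subset by blast
  qed
  show "\<rho> \<le> T / 2"
  proof (rule ccontr)
    assume "\<not> \<rho> \<le> T / 2"
    then have "?b \<le> 0"
      using \<open>0 < vm\<close> \<open>vm \<le> vM\<close> by (simp add: mult_le_0_iff)
    then have "open_segment c d \<subseteq> open_segment p\<^sub>0 q\<^sub>0"
      if "(i, j) \<in> ?G\<^sup>*" "stays_on_street \<phi> T \<rho> (p j) c d" for j c d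
      using joined[OF that] unfolding street_joined_def by (metis not_le order_refl)
    then show False
      using unbdd_streets[OF bounded_open_segment[of p\<^sub>0 q\<^sub>0]] by blast
  qed
  show "street_percolates \<phi> ?a ?b"
  proof (rule ccontr)
    assume "\<not> street_percolates \<phi> ?a ?b"
    then have "component_length \<phi> ?a ?b p\<^sub>0 \<noteq> \<infinity>"
      unfolding street_percolates_def component_length_def by blast
    then obtain B where B: "0 \<le> B" "component_length \<phi> ?a ?b p\<^sub>0 = ennreal B"
      by (cases "component_length \<phi> ?a ?b p\<^sub>0") auto
    have near: "u \<in> cball p\<^sub>0 B" if "u \<in> street_component \<phi> ?a ?b p\<^sub>0" for u
      using dist_le_component_length[OF that] B by (simp add: ennreal_le_iff)
    have "open_segment c d \<subseteq> open_segment p\<^sub>0 q\<^sub>0 \<union> cball p\<^sub>0 B"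
      if "(i, j) \<in> ?G\<^sup>*" "stays_on_street \<phi> T \<rho> (p j) c d" for j c d
    proof -
      have "open_segment c d \<subseteq> cball p\<^sub>0 B" if "c \<in> cball p\<^sub>0 B" "d \<in> cball p\<^sub>0 B"
        using closed_segment_subset[OF that convex_cball] segment_open_subset_closed by blast
      then show ?thesis
        using joined[OF that] near unfolding street_joined_def by blast
    qed
    then show False
      using unbdd_streets[of "open_segment p\<^sub>0 q\<^sub>0 \<union> cball p\<^sub>0 B"] by (auto simp: bounded_open_segment)
  qed
qed

section \<open>Velocities of the devices\<close>

lemma velocity_distribution_bounds:
  assumes "velocity_distribution \<mu>"
  obtains vm vM where "v_min \<mu> = ereal vm" and "v_max \<mu> = ereal vM" and "0 < vm" and "vm \<le> vM"
    and "measure \<mu> {vm..vM} = 1"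
proof -
  interpret prob_space \<mu>
    using assms by (simp add: velocity_distribution_def)
  have sets: "sets \<mu> = sets borel" and bounds: "0 < v_min \<mu>" "v_min \<mu> \<le> v_max \<mu>" "v_max \<mu> < \<infinity>"
    using assms by (simp_all add: velocity_distribution_def)
  obtain vm where vm: "v_min \<mu> = ereal vm"
    using bounds by (cases "v_min \<mu>") auto
  obtain vM where vM: "v_max \<mu> = ereal vM"
    using bounds vm by (cases "v_max \<mu>") auto
  have "AE v in \<mu>. vm - 1 / Suc n < v" for n
  proof -
    have "ereal (vm - 1 / Suc n) < v_min \<mu>"
      by (simp add: vm)
    then obtain w where w: "measure \<mu> {w..} = 1" "vm - 1 / Suc n < w"
      unfolding v_min_def less_SUP_iff by auto
    then show ?thesis
      using AE_prob_1[OF w(1)] by (auto elim: eventually_mono)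
  qed
  moreover have "AE v in \<mu>. v < vM + 1 / Suc n" for n
  proof -
    have "v_max \<mu> < ereal (vM + 1 / Suc n)"
      by (simp add: vM)
    then obtain w where w: "measure \<mu> {0..w} = 1" "w < vM + 1 / Suc n"
      unfolding v_max_def INF_less_iff by auto
    then show ?thesis
      using AE_prob_1[OF w(1)] by (auto elim: eventually_mono)
  qed
  ultimately have "AE v in \<mu>. \<forall>n. vm - 1 / Suc n < v \<and> v < vM + 1 / Suc n"
    by (simp add: AE_all_countable)
  then have "AE v in \<mu>. v \<in> {vm..vM}"
  proof (rule eventually_mono)
    fix v
    assume v: "\<forall>n. vm - 1 / Suc n < v \<and> v < vM + 1 / Suc n"
    have "(\<lambda>n. vm - 1 / Suc n) \<longlonglongrightarrow> vm - 0" "(\<lambda>n. vM + 1 / Suc n) \<longlonglongrightarrow> vM + 0"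
      by (intro tendsto_intros LIMSEQ_Suc[OF lim_1_over_n])+
    then show "v \<in> {vm..vM}"
      using v by (auto intro: LIMSEQ_le_const LIMSEQ_le_const2 less_imp_le)
  qed
  then have "measure \<mu> {vm..vM} = 1"
    using sets by (subst prob_eq_1) auto
  then show thesis
    using that vm vM bounds by simp
qed

text \<open>The conditional law of the velocities determines their unconditional null events.\<close>

lemma (in device_model) velocity_AE:
  assumes "B \<in> sets borel" and "prob_space \<mu>" and "sets \<mu> = sets borel" and "measure \<mu> B = 1"
  shows "AE \<omega> in M. \<forall>i\<in>I \<omega>. V i \<omega> \<in> B"
proof -
  interpret \<mu>: prob_space \<mu>
    by fact
  define h where "h = (\<lambda>\<omega>. (S \<omega>, \<lambda>i. (i \<in> I \<omega>, if i \<in> I \<omega> then X i \<omega> else 0)))"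
  define N where "N = config_space \<Otimes>\<^sub>M Pi\<^sub>M (UNIV :: nat set)
      (\<lambda>_. count_space (UNIV :: bool set) \<Otimes>\<^sub>M (borel :: point measure))"
  have [measurable]: "Measurable.pred M (\<lambda>\<omega>. i \<in> I \<omega>)" for i
    using I_measurable by (simp add: pred_def)
  note [measurable] = S_measurable X_measurable Y_measurable V_measurable
  have "h \<in> M \<rightarrow>\<^sub>M N"
    unfolding h_def N_def
    by (intro measurable_Pair S_measurable measurable_PiM_single') (auto simp: space_pair_measure)
  then have "subalgebra M (vimage_algebra (space M) h N)"
    unfolding subalgebra_def using sets_image_in_sets[OF refl] by simp
  then interpret F: finite_measure_subalgebra M "vimage_algebra (space M) h N"
    by unfold_locales
  have null: "AE \<omega> in M. i \<in> I \<omega> \<longrightarrow> V i \<omega> \<in> B" for i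
  proof -
    define E where "E = {\<omega> \<in> space M. i \<in> I \<omega> \<and> V i \<omega> \<in> - B}"
    have E: "E \<in> sets M"
      unfolding E_def using \<open>B \<in> sets borel\<close> by measurable
    have "measure \<mu> (- B) = 0"
      using \<mu>.prob_compl[of B] assms sets_eq_imp_space_eq[OF assms(3)] by (simp add: Compl_eq_Diff_UNIV)
    moreover have "{\<omega> \<in> space M. {i} \<subseteq> I \<omega> \<and> (\<forall>i\<in>{i}. Y i \<omega> \<in> UNIV \<and> V i \<omega> \<in> - B)} = E"
      by (auto simp: E_def)
    ultimately have "AE \<omega> in M. real_cond_exp M (vimage_algebra (space M) h N) (indicator E) \<omega> = 0"
      using targets_velocities[of "{i}" "\<lambda>_. UNIV" "\<lambda>_. - B"] \<open>B \<in> sets borel\<close>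
      by (simp add: h_def N_def)
    then have "(\<integral>\<omega>. real_cond_exp M (vimage_algebra (space M) h N) (indicator E) \<omega> \<partial>M) = 0"
      by (rule integral_eq_zero_AE)
    then have "(\<integral>\<omega>. indicator E \<omega> \<partial>M) = (0 :: real)"
      using F.real_cond_exp_int(2)[of "indicator E"] E
      by (simp add: integrable_indicator_iff emeasure_eq_measure)
    then have "E \<in> null_sets M"
      using E by (simp add: null_sets_def emeasure_eq_measure)
    then show ?thesis
      by (intro AE_I'[of E]) (auto simp: E_def)
  qed
  then have "AE \<omega> in M. \<forall>i. i \<in> I \<omega> \<longrightarrow> V i \<omega> \<in> B"
    by (simp add: AE_all_countable)
  then show ?thesis
    by (rule eventually_mono) blast
qed

section \<open>Comparison of the critical values\<close>

theorem theorem2p4: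
  fixes M :: "'w measure" and L :: "config measure" and \<kappa> :: "config \<Rightarrow> point \<Rightarrow> point measure"
    and \<mu> :: "real measure" and lam T r :: real
  assumes "street_system_law L" and "waypoint_kernel \<kappa>" and "velocity_distribution \<mu>"
    and "0 \<le> lam" and "0 \<le> T" and "0 \<le> r"
    and "device_model M L \<kappa> \<mu> lam S I X Y V pos"
  shows "rho_c M S I X pos T r \<le> min (ereal (T / 2)) (rho_c' L T \<mu>)"
proof -
  interpret device_model M L \<kappa> \<mu> lam S I X Y V pos
    by fact
  obtain vm vM where v: "v_min \<mu> = ereal vm" "v_max \<mu> = ereal vM" "0 < vm" "vm \<le> vM"
    "measure \<mu> {vm..vM} = 1"
    by (rule velocity_distribution_bounds[OF assms(3)])
  have \<mu>: "prob_space \<mu>" "sets \<mu> = sets borel"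
    using assms(3) by (simp_all add: velocity_distribution_def)
  have "space config_space = configs"
    by (auto simp: config_space_def intro!: space_measure_of)
  then have "AE \<omega> in M. S \<omega> \<in> configs"
    using measurable_space[OF S_measurable] by auto
  moreover have "AE \<omega> in M. \<forall>i\<in>I \<omega>. V i \<omega> \<in> {vm..vM}"
    using \<mu> v(5) by (intro velocity_AE) auto
  ultimately have realization: "AE \<omega> in M. S \<omega> \<in> configs \<and>
      (\<forall>i\<in>I \<omega>. vm \<le> V i \<omega> \<and> V i \<omega> \<le> vM \<and> commutes (\<Union>(S \<omega>)) (X i \<omega>) (Y i \<omega>) (V i \<omega>) (pos i \<omega>))"
    using motion by eventually_elim auto
  show ?thesis
    unfolding rho_c_def
  proof (rule Sup_least, clarify)
    fix \<rho> :: real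
    assume "0 \<le> \<rho>"
    let ?conn = "\<lambda>\<omega>. connection_percolates T \<rho> r (S \<omega>) (I \<omega>) (\<lambda>i. X i \<omega>) (\<lambda>i. pos i \<omega>)"
    let ?street = "\<lambda>\<phi>. street_percolates \<phi> (vm * \<rho> / 2) (vM * (T - 2 * \<rho>))"
    assume pos: "positive_prob M ?conn"
    have imp: "AE \<omega> in M. ?conn \<omega> \<longrightarrow> \<rho> \<le> T / 2 \<and> ?street (S \<omega>)"
      using realization
    proof eventually_elim
      case (elim \<omega>)
      then show ?case
        using connection_percolates_imp_street_percolates[of "S \<omega>" vm vM \<rho> "I \<omega>" "\<lambda>i. V i \<omega>"
            "\<lambda>i. X i \<omega>" "\<lambda>i. Y i \<omega>" "\<lambda>i. pos i \<omega>" T r] v(3,4) \<open>0 \<le> \<rho>\<close>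
        by blast
    qed
    have "\<rho> \<le> T / 2"
    proof (rule ccontr)
      assume "\<not> \<rho> \<le> T / 2"
      with imp have "AE \<omega> in M. \<not> ?conn \<omega>"
        by simp
      with pos show False
        by (simp add: positive_prob_def)
    qed
    moreover have "positive_prob L ?street"
      unfolding positive_prob_def
    proof
      assume "AE \<phi> in L. \<not> ?street \<phi>"
      then have "AE \<omega> in M. \<not> ?street (S \<omega>)"
        unfolding S_law[symmetric] by (rule AE_distrD[OF S_measurable])
      with imp have "AE \<omega> in M. \<not> ?conn \<omega>"
        by eventually_elim auto
      with pos show False
        by (simp add: positive_prob_def)
    qed
    ultimately have "ereal \<rho> \<le> rho_c' L T \<mu>"
      unfolding rho_c'_def using \<open>0 \<le> \<rho>\<close> v(1,2) by (intro Sup_upper) auto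
    with \<open>\<rho> \<le> T / 2\<close> show "ereal \<rho> \<le> min (ereal (T / 2)) (rho_c' L T \<mu>)"
      by simp
  qed
qed

end
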